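(* Let $f,u,p,\mathcal F$ satisfy assumption (E), $A,b$ assumption (AB) and the costs $c_h$ assumption (C) of the context. There exist $h_0,\varepsilon_0>0$, depending only on the constants in the assumptions, such that for all $0<h<h_0$, $0<\varepsilon<\varepsilon_0$ with $\frac{\varepsilon}{h}\le1$ and all $\mu\in\mathcal P_2^r(\mathbb R^d)$ with $\mathcal F(\mu)<\infty$, there exists a unique $\nu^*\in\mathcal P_2^r(\mathbb R^d)$ such that $$\nu^*=\underset{\nu\in\mathcal P_2^r(\mathbb R^d)}{\mathrm{argmin}}\Big\{\frac1{2h}\mathcal W_{c_h,\varepsilon}(\mu,\nu)+\mathcal F(\nu)\Big\}.$$
   Context: Notation. $\|\cdot\|$ is the Euclidean norm. $M(\rho)=\int\|x\|^2\rho(dx)$; $\mathcal P_2(\mathbb R^d)$ is the set of Borel probability measures on $\mathbb R^d$ with $M(\rho)<\infty$, and $\mathcal P_2^r(\mathbb R^d)$ is its subset of measures absolutely continuous with respect to Lebesgue measure (identified with their densities). $H(\rho)=\int\rho\log\rho$ if $\rho\in\mathcal P_2^r$ and $H(\rho)=+\infty$ otherwise (same definition on $\mathbb R^{2d}$). $\Pi(\mu,\nu)$ is the set of couplings of $\mu,\nu$. $\mathcal W_{c_h,\varepsilon}(\mu,\nu):=\inf_{\gamma\in\Pi(\mu,\nu)}\{\int_{\mathbb R^{2d}}c_h\,d\gamma+\varepsilon H(\gamma)\}$. A quantity is $O(\varphi(h))$ if it is bounded in absolute value by $C\varphi(h)$ for all small $h$, with $C$ independent of all other variables and parameters; a matrix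 is $O(h)$ if all its entries are. Below $C>0$ denotes fixed constants independent of $h,\varepsilon$. (E) Free energy. $\mathcal F(\rho)=F(\rho)+U(\rho)$ on $\mathcal P_2^r(\mathbb R^d)$, $F(\rho)=\int f\rho\,dx$, $U(\rho)=\int u(\rho(x))dx$. Here $u:[0,\infty)\to\mathbb R$, $u\in C^2((0,\infty))$, $u$ is convex, $u(0)=0$, $\lim_{s\to\infty}u(s)/s=\infty$, and $u(s)\ge -Cs^\alpha$ for some $\frac d{d+2}<\alpha<1$. The pressure $p(s):=u'(s)s-u(s)$ satisfies, for some $m\in\mathbb N$, $p(s)\le Cs^m$ and $p'(s)\ge s^{m-1}/C$; and $\frac1C\int\rho^m dx\le C M(\rho)+U(\rho)$ for all $\rho\in\mathcal P_2^r(\mathbb R^d)$. $f\in C(\mathbb R^d)$, $f\ge0$, $|f(x)-f(y)|\le C\|x-y\|$. (AB) $A\in\mathbb R^{d\times d}$ is a constant symmetric (possibly singular) matrix; $b:\mathbb R^d\to\mathbb R^d$ is Lipschitz. (C) Cost. For all sufficiently small $h>0$ the map $c_h:\mathbb R^{2d}\to\mathbb R$ is continuous and: (1) for each $x$, $y\mapsto c_h(x,y)$ is differentiable; (2) there is a real $d\times d$ matrix $B_h$ of order $O(h)$ such that for all $\eta,x,y\in\mathbb R^d$, with $\tilde\eta:=(A+B_h)\eta$, $\langle\nabla_yc_h(x,y),\tilde\eta\rangle-\langle2(y-x)-2hb(y),\eta\rangle=O(h^2)(1+\|\eta\|)(\|x\|^2+\|y\|^2+1)+O(1)c_h(x,y)$;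 (3) $\|\nabla_yc_h(x,y)\|\le C(h)(\|x\|^2+\|y\|^2+1)$ for some constant $C(h)$ possibly depending on $h$; (4) $\|x-y\|^2\le C\big(c_h(x,y)+h^2(\|x\|^2+\|y\|^2)\big)$, $c_h(x,y)\le C(h)(\|x\|^2+\|y\|^2)$ for some constant $C(h)$ possibly depending on $h$, and $c_h(x,y)\ge0$. *)

theory Defs
  imports "HOL-Probability.Probability"
begin

text \<open>
  Integral with values in the extended reals, defined as the integral of the positive part minus
  that of the negative part. It is the intended integral as soon as one of the two parts is finite,
  which is the case for every integrand occurring below (under the standing assumptions).
\<close>

definition eintegral :: "'a measure \<Rightarrow> ('a \<Rightarrow> real) \<Rightarrow> ereal" where
  "eintegral M g =
     enn2ereal (\<integral>\<^sup>+x. ennreal (g x) \<partial>M) - enn2ereal (\<integral>\<^sup>+x. ennreal (- g x) \<partial>M)"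

definition second_moment :: "'a::euclidean_space measure \<Rightarrow> ereal" where
  "second_moment \<rho> = eintegral \<rho> (\<lambda>x. (norm x)\<^sup>2)"

definition P2 :: "'a::euclidean_space measure set" where
  "P2 = {\<rho>. prob_space \<rho> \<and> sets \<rho> = sets borel \<and> second_moment \<rho> < \<infinity>}"

definition P2r :: "'a::euclidean_space measure set" where
  "P2r = {\<rho> \<in> P2. absolutely_continuous lborel \<rho>}"

definition dens :: "'a::euclidean_space measure \<Rightarrow> 'a \<Rightarrow> real" where
  "dens \<rho> x = enn2real (RN_deriv lborel \<rho> x)"

definition entropy_fun :: "'a::euclidean_space measure \<Rightarrow> ereal" where
  "entropy_fun \<rho> =
     (if \<rho> \<in> P2r then eintegral lborel (\<lambda>x. dens \<rho> x * ln (dens \<rho> x)) else \<infinity>)"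

definition couplings ::
    "'a::euclidean_space measure \<Rightarrow> 'a measure \<Rightarrow> ('a \<times> 'a) measure set" where
  "couplings \<mu> \<nu> =
     {\<gamma>. prob_space \<gamma> \<and> sets \<gamma> = sets borel \<and> distr \<gamma> borel fst = \<mu> \<and> distr \<gamma> borel snd = \<nu>}"

definition reg_cost ::
    "('a::euclidean_space \<times> 'a \<Rightarrow> real) \<Rightarrow> real \<Rightarrow> 'a measure \<Rightarrow> 'a measure \<Rightarrow> ereal" where
  "reg_cost c \<epsilon> \<mu> \<nu> = (INF \<gamma>\<in>couplings \<mu> \<nu>. eintegral \<gamma> c + ereal \<epsilon> * entropy_fun \<gamma>)"

definition potential_energy ::
    "('a::euclidean_space \<Rightarrow> real) \<Rightarrow> 'a measure \<Rightarrow> ereal" where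
  "potential_energy f \<rho> = eintegral lborel (\<lambda>x. f x * dens \<rho> x)"

definition internal_energy :: "(real \<Rightarrow> real) \<Rightarrow> 'a::euclidean_space measure \<Rightarrow> ereal" where
  "internal_energy u \<rho> = eintegral lborel (\<lambda>x. u (dens \<rho> x))"

definition free_energy ::
    "('a::euclidean_space \<Rightarrow> real) \<Rightarrow> (real \<Rightarrow> real) \<Rightarrow> 'a measure \<Rightarrow> ereal" where
  "free_energy f u \<rho> = potential_energy f \<rho> + internal_energy u \<rho>"

definition pressure :: "(real \<Rightarrow> real) \<Rightarrow> real \<Rightarrow> real" where
  "pressure u s = deriv u s * s - u s"

definition grad :: "('a::euclidean_space \<Rightarrow> real) \<Rightarrow> 'a \<Rightarrow> 'a" where
  "grad g x = (THE D. GDERIV g x :> D)"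

text \<open>
  In the three assumptions below a single constant \<open>C\<close> stands for all the fixed constants
  independent of \<open>h\<close> and \<open>\<epsilon>\<close>, including those implicit in the O-notation and the Lipschitz constants;
  this is no restriction, because every bound remains true when its constant is enlarged. The
  function \<open>u\<close> matters only on the half-line of nonnegative reals.
  The \<open>powr\<close> in the lower bound on the derivative of the pressure avoids truncated subtraction.
\<close>

definition assumption_E ::
    "real \<Rightarrow> real \<Rightarrow> nat \<Rightarrow> (real ^ 'n \<Rightarrow> real) \<Rightarrow> (real \<Rightarrow> real) \<Rightarrow> bool" where
  "assumption_E C \<alpha> m f u \<longleftrightarrow>
     u C1_differentiable_on {0<..} \<and> deriv u C1_differentiable_on {0<..} \<and>
     convex_on {0..} u \<and> u 0 = 0 \<and>
     filterlim (\<lambda>s. u s / s) at_top at_top \<and>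
     real CARD('n) / (real CARD('n) + 2) < \<alpha> \<and> \<alpha> < 1 \<and>
     (\<forall>s\<ge>0. u s \<ge> - C * s powr \<alpha>) \<and>
     (\<forall>s>0. pressure u s \<le> C * s ^ m) \<and>
     (\<forall>s>0. deriv (pressure u) s \<ge> s powr (real m - 1) / C) \<and>
     (\<forall>\<rho>\<in>(P2r :: (real ^ 'n) measure set).
        ereal (1 / C) * eintegral lborel (\<lambda>x. dens \<rho> x ^ m)
          \<le> ereal C * second_moment \<rho> + internal_energy u \<rho>) \<and>
     continuous_on UNIV f \<and> (\<forall>x. f x \<ge> 0) \<and> (\<forall>x y. \<bar>f x - f y\<bar> \<le> C * norm (x - y))"

definition assumption_AB ::
    "real \<Rightarrow> real ^ 'n ^ 'n \<Rightarrow> (real ^ 'n \<Rightarrow> real ^ 'n) \<Rightarrow> bool" where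
  "assumption_AB C A b \<longleftrightarrow> transpose A = A \<and> C-lipschitz_on UNIV b"

text \<open>
  The constant \<open>hbar\<close> is the threshold below which the conditions on the cost hold. The matrix \<open>B\<close>
  and the constant \<open>K\<close> may depend on \<open>h\<close>.
\<close>

definition assumption_C ::
    "real \<Rightarrow> real \<Rightarrow> real ^ 'n ^ 'n \<Rightarrow> (real ^ 'n \<Rightarrow> real ^ 'n) \<Rightarrow>
     (real \<Rightarrow> (real ^ 'n) \<times> (real ^ 'n) \<Rightarrow> real) \<Rightarrow> bool" where
  "assumption_C C hbar A b c \<longleftrightarrow>
     (\<forall>h. 0 < h \<and> h < hbar \<longrightarrow>
        continuous_on UNIV (c h) \<and>
        (\<forall>x y. (\<lambda>y. c h (x, y)) differentiable (at y)) \<and>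
        (\<exists>B :: real ^ 'n ^ 'n.
           (\<forall>i j. \<bar>B $ i $ j\<bar> \<le> C * h) \<and>
           (\<forall>\<eta> x y.
              \<bar>grad (\<lambda>y. c h (x, y)) y \<bullet> ((A + B) *v \<eta>)
                 - (2 *\<^sub>R (y - x) - (2 * h) *\<^sub>R b y) \<bullet> \<eta>\<bar>
              \<le> C * (h\<^sup>2 * (1 + norm \<eta>) * ((norm x)\<^sup>2 + (norm y)\<^sup>2 + 1)) + C * \<bar>c h (x, y)\<bar>)) \<and>
        (\<exists>K. \<forall>x y. norm (grad (\<lambda>y. c h (x, y)) y) \<le> K * ((norm x)\<^sup>2 + (norm y)\<^sup>2 + 1)) \<and>
        (\<forall>x y. (norm (x - y))\<^sup>2 \<le> C * (c h (x, y) + h\<^sup>2 * ((norm x)\<^sup>2 + (norm y)\<^sup>2))) \<and>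
        (\<exists>K. \<forall>x y. c h (x, y) \<le> K * ((norm x)\<^sup>2 + (norm y)\<^sup>2)) \<and>
        (\<forall>x y. c h (x, y) \<ge> 0))"

end

theory Submission
  imports Defs
begin

text \<open>
  The functional is minimised directly over transport plans, represented by densities \<open>g\<close> on the
  product space whose first marginal is \<open>\<mu>\<close>:
  \<open>J g = (\<integral> c g + \<epsilon> \<integral> g ln g) / (2 h) + \<integral> f \<rho> + \<integral> u(\<rho>)\<close>, with \<open>\<rho>\<close> the second marginal of \<open>g\<close>.
  By Young's inequality the growth bound \<open>u s \<ge> - C s\<^sup>\<alpha>\<close> gives \<open>u s + \<delta> (1 + |x|\<^sup>2) s + q x \<ge> 0\<close>
  with \<open>q\<close> integrable, for every \<open>\<delta> > 0\<close>, and likewise for \<open>s ln s\<close>; together with the coercivity of the cost this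
  bounds \<open>J\<close> below and controls second moments, and it makes Fatou's lemma applicable.
  The entropy is uniformly convex in \<open>L\<^sup>1\<close>, so every minimising sequence of densities is Cauchy in \<open>L\<^sup>1\<close>;
  its limit is a minimiser by lower semicontinuity, and no weak compactness is needed. The same estimate,
  applied to two near-optimal plans, gives uniqueness of the second marginal.
\<close>

subsection \<open>Elementary inequalities\<close>

text \<open>As a function of \<nu> the regularised cost is itself an infimum, so optimal plans would
  have to be tracked along a minimising sequence of measures. Over plans, cost and potential are
  linear, \<open>u\<close> and the entropy are convex, and strictness is drawn from the entropy
  alone. The obstacle is the sign: both convex integrands may be negative on a domain of infinite
  volume. A sublinear bound s^a leaves, after Young's inequality, a remainder of order (1 +
  |x|^2)^(-a/(1-a)), and this is integrable on R^n exactly when a > n/(n+2); this is where that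
  threshold comes from. The moment that Young's inequality charges can only be paid by the cost, and
  the cost controls |y|^2 only once h is so small that its error h^2 (|x|^2 + |y|^2) can be
  absorbed. The competitor that makes the infimum finite is the product of \<mu> with itself. It
  requires finite entropy of \<mu>, which is not among the hypotheses and is derived from the finite
  free energy through the growth of the pressure.\<close>

abbreviation mweight :: "'a::real_normed_vector \<Rightarrow> real" where
  "mweight x \<equiv> 1 + (norm x)\<^sup>2"

lemma mweight_ge_1: "1 \<le> mweight x" and mweight_pos: "0 < mweight x"
  by (auto simp: add_pos_nonneg)

text \<open>Dyadic decomposition: with 2^k <= 1 + |x| < 2^(k+1), the point lies in a ball of radius
  comparable to 2^k while the weight is at least 4^k / 2. Volume growth can then be weighed against
  decay shell by shell.\<close>

lemma mweight_powr_le_shell: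
  fixes x :: "'a::real_normed_vector"
  assumes "0 < \<beta>"
  shows "\<exists>k. x \<in> cball 0 (2 * 2 ^ k) \<and> mweight x powr (- \<beta>) \<le> 2 powr \<beta> * (4 powr (- \<beta>)) ^ k"
proof -
  define k where "k = nat \<lfloor>log 2 (1 + norm x)\<rfloor>"
  have l0: "0 \<le> log 2 (1 + norm x)" by (subst zero_le_log_cancel_iff) (auto simp: add_pos_nonneg)
  have k1: "real k \<le> log 2 (1 + norm x)" "log 2 (1 + norm x) < real k + 1"
    using l0 unfolding k_def by linarith+
  have pos: "0 < 1 + norm x" by (simp add: add_pos_nonneg)
  have "2 powr real k \<le> 1 + norm x"
    using k1(1) pos by (simp add: le_log_iff)
  then have a: "2 ^ k \<le> 1 + norm x" by (simp add: powr_realpow)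
  have "1 + norm x < 2 powr (real k + 1)"
    using k1(2) pos by (simp add: log_less_iff)
  then have b: "norm x \<le> 2 * 2 ^ k" by (simp add: powr_add powr_realpow)
  have "(4::real) ^ k = (2 ^ k)\<^sup>2" by (simp add: power2_eq_square flip: power_mult_distrib)
  also have "\<dots> \<le> (1 + norm x)\<^sup>2" using a by (intro power_mono) auto
  also have "\<dots> \<le> 2 * mweight x"
    using zero_le_power2[of "1 - norm x"] by (simp add: power2_eq_square algebra_simps)
  finally have "4 ^ k / 2 \<le> mweight x" by simp
  then have "mweight x powr (- \<beta>) \<le> (4 ^ k / 2) powr (- \<beta>)"
    using assms by (intro powr_mono2') auto
  also have "\<dots> = 2 powr \<beta> * (4 ^ k) powr (- \<beta>)"
    by (simp add: powr_divide powr_minus divide_simps)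
  also have "(4 ^ k) powr (- \<beta>) = (4 powr (- \<beta>)) ^ k"
    by (simp add: powr_power powr_realpow[symmetric] powr_powr mult.commute)
  finally show ?thesis using b by (intro exI[of _ k]) auto
qed

text \<open>A sum of ball volumes takes the place of polar coordinates. In the ratio
  \<open>q\<close> of the geometric series, 4^(-\<beta>) comes from the weight and 2^n from the
  volume; the hypothesis says exactly that q = 2^(n - 2 \<beta>) < 1.\<close>

lemma integrable_mweight_powr:
  assumes "real DIM('a::euclidean_space) < 2 * \<beta>"
  shows "integrable lborel (\<lambda>x::'a. mweight x powr (- \<beta>))"
proof (rule integrableI_nonneg)
  let ?n = "DIM('a)"
  have \<beta>: "0 < \<beta>" using assms of_nat_0_le_iff[of ?n] by linarith
  define q where "q = 4 powr (- \<beta>) * 2 ^ ?n"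
  define A where "A = 2 powr \<beta> * (unit_ball_vol ?n * 2 ^ ?n)"
  have q0: "0 \<le> q" and A0: "0 \<le> A" unfolding q_def A_def by auto
  have "q = 2 powr (real ?n - 2 * \<beta>)"
    unfolding q_def using powr_powr[of 2 2 "-\<beta>"] by (simp add: powr_diff powr_realpow powr_minus divide_simps)
  then have q1: "q < 1" using assms by (simp add: powr_less_one)
  define s where "s k = 2 powr \<beta> * (4 powr (- \<beta>)) ^ k" for k
  have "(\<integral>\<^sup>+x. ennreal (mweight (x::'a) powr (- \<beta>)) \<partial>lborel)
      \<le> (\<integral>\<^sup>+x. (\<Sum>k. ennreal (s k) * indicator (cball 0 (2 * 2 ^ k)) (x::'a)) \<partial>lborel)"
  proof (rule nn_integral_mono)
    fix x :: 'a
    obtain k where k: "x \<in> cball 0 (2 * 2 ^ k)" "mweight x powr (- \<beta>) \<le> s k"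
      using mweight_powr_le_shell[OF \<beta>, of x] unfolding s_def by blast
    define t where "t k = ennreal (s k) * indicator (cball 0 (2 * 2 ^ k)) x" for k
    have "ennreal (mweight x powr (- \<beta>)) \<le> sum t {k}" using k by (simp add: t_def ennreal_leI)
    also have "\<dots> \<le> (\<Sum>k. t k)" by (rule sum_le_suminf) auto
    finally show "ennreal (mweight x powr (- \<beta>))
      \<le> (\<Sum>k. ennreal (s k) * indicator (cball 0 (2 * 2 ^ k)) x)" by (simp only: t_def)
  qed
  also have "\<dots> = (\<Sum>k. \<integral>\<^sup>+x. ennreal (s k) * indicator (cball 0 (2 * 2 ^ k)) (x::'a) \<partial>lborel)"
    by (rule nn_integral_suminf, simp, intro borel_measurable_times_ennreal borel_measurable_const borel_measurable_indicator) simp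
  also have "\<dots> = (\<Sum>k. ennreal (A * q ^ k))"
  proof (rule suminf_cong)
    fix k
    have "(\<integral>\<^sup>+x. ennreal (s k) * indicator (cball 0 (2 * 2 ^ k)) (x::'a) \<partial>lborel)
        = ennreal (s k) * ennreal (unit_ball_vol ?n * (2 * 2 ^ k) ^ ?n)"
      by (subst nn_integral_cmult_indicator) (auto simp: emeasure_cball)
    also have "\<dots> = ennreal (s k * (unit_ball_vol ?n * (2 * 2 ^ k) ^ ?n))"
      by (rule ennreal_mult[symmetric]) (auto simp: s_def)
    also have "s k * (unit_ball_vol ?n * (2 * 2 ^ k) ^ ?n) = A * q ^ k"
      unfolding s_def A_def q_def
      by (simp add: power_mult_distrib algebra_simps flip: power_mult)
    finally show "(\<integral>\<^sup>+x. ennreal (s k) * indicator (cball 0 (2 * 2 ^ k)) (x::'a) \<partial>lborel)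
        = ennreal (A * q ^ k)" .
  qed
  also have "\<dots> < \<infinity>"
  proof -
    have "summable (\<lambda>k. A * q ^ k)"
      using q0 q1 by (intro summable_mult summable_geometric) auto
    then show ?thesis
      using q0 A0 by (simp add: less_top ennreal_suminf_neq_top)
  qed
  finally show "(\<integral>\<^sup>+x. ennreal (mweight (x::'a) powr (- \<beta>)) \<partial>lborel) < \<infinity>" .
qed auto

text \<open>Young's inequality with exponents 1/a and 1/(1-a), where \<open>s\<close> is paired with
  the weight. The inverse weight left over carries the exponent a/(1-a), which decides later whether
  the remainder is integrable.\<close>

lemma powr_le_weighted:
  fixes a K \<delta> :: real
  assumes a: "0 < a" "a < 1" and "0 \<le> K" "0 < \<delta>"
  shows "\<exists>Q\<ge>0. \<forall>s\<ge>0. \<forall>w>0. K * s powr a \<le> \<delta> * w * s + Q * w powr (- (a / (1 - a)))"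
proof (cases "K = 0")
  case True
  then show ?thesis using assms by (intro exI[of _ 0]) auto
next
  case False
  then have K: "0 < K" using assms by simp
  define b where "b = a / (1 - a)"
  \<comment> \<open>Dividing by \<open>K\<close> reduces the claim to coefficient one.\<close>
  define e where "e = \<delta> / K"
  have e: "0 < e" using K assms by (simp add: e_def)
  have b: "b * (1 - a) = a" using a by (simp add: b_def)
  have main: "s powr a \<le> e * w * s + e powr (- b) * w powr (- b)" if "0 \<le> s" "0 < w" for s w
  proof (cases "s = 0")
    case True
    then show ?thesis using a by simp
  next
    case False
    then have s: "0 < s" using that by simp
    let ?t = "e * w"
    have t: "0 < ?t" using e that by simp
    \<comment> \<open>The second factor is chosen because b (1 - a) = a: it cancels the weight
      introduced into the first.\<close>
    have "(?t * s) powr a * (?t powr (- b)) powr (1 - a) \<le> a * (?t * s) + (1 - a) * ?t powr (- b)"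
      using a s t by (intro Youngs_inequality_0) auto
    also have "\<dots> \<le> 1 * (?t * s) + 1 * ?t powr (- b)"
      using a s t by (intro add_mono mult_right_mono) auto
    finally have "?t powr a * s powr a * ?t powr (- a) \<le> ?t * s + ?t powr (- b)"
      using t s b by (simp add: powr_powr powr_mult)
    moreover have "?t powr a * s powr a * ?t powr (- a) = s powr a"
      using t by (metis less_irrefl mult.commute mult.left_neutral mult.assoc powr_add powr_zero_eq_one add.right_inverse)
    moreover have "?t powr (- b) = e powr (- b) * w powr (- b)"
      using e that by (simp add: powr_mult)
    ultimately show ?thesis by simp
  qed
  have "K * s powr a \<le> \<delta> * w * s + (K * e powr (- b)) * w powr (- b)" if "0 \<le> s" "0 < w" for s w
    using mult_left_mono[OF main[OF that], of K] K by (simp add: e_def algebra_simps)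
  then show ?thesis unfolding b_def[symmetric]
    using K by (intro exI[of _ "K * e powr (- b)"]) auto
qed

text \<open>Pointwise comparison of the squared Hellinger distance with the relative entropy: ln t
  <= t - 1 at t = sqrt (s / a), multiplied by 2 a. The linear terms \<open>- a + s\<close> replace a
  normalisation of the masses.\<close>

lemma mul_ln_gap:
  fixes a s :: real
  assumes "0 \<le> a" "0 < s"
  shows "(sqrt a - sqrt s)\<^sup>2 \<le> a * ln a - a * ln s - a + s"
proof (cases "a = 0")
  case True
  then show ?thesis using assms by simp
next
  case False
  then have a: "0 < a" using assms by simp
  have "ln (sqrt s / sqrt a) \<le> sqrt s / sqrt a - 1" using a assms by (intro ln_le_minus_one) auto
  then have "ln s / 2 - ln a / 2 \<le> sqrt s / sqrt a - 1" using a assms by (simp add: ln_div ln_sqrt)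
  then have "ln s - ln a \<le> 2 * (sqrt s / sqrt a - 1)" by argo
  then have "a * (ln s - ln a) \<le> a * (2 * (sqrt s / sqrt a - 1))" using a by (intro mult_left_mono) auto
  also have "\<dots> = 2 * (sqrt a * sqrt s) - 2 * a"
    using a by (simp add: field_simps)
  finally show ?thesis using a assms by (simp add: power2_eq_square algebra_simps)
qed

text \<open>Integrated, this bounds an \<open>L\<^sup>1\<close> distance by the midpoint convexity gap of the entropy.\<close>

lemma abs_diff_le_entropy_gap:
  fixes a b t :: real
  assumes "0 \<le> a" "0 \<le> b" "0 < t"
  shows "\<bar>a - b\<bar> \<le> (a * ln a + b * ln b - 2 * ((a + b) / 2 * ln ((a + b) / 2))) / t + 3 * t * (a + b)"
proof (cases "a + b = 0")
  case True
  then have "a = 0" "b = 0" using assms by auto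
  then show ?thesis by simp
next
  case False
  define s where "s = (a + b) / 2"
  define G where "G = a * ln a + b * ln b - 2 * (s * ln s)"
  have s: "0 < s" using False assms by (simp add: s_def)
  have ab: "a + b = 2 * s" by (simp add: s_def)
  \<comment> \<open>Since a + b = 2 s, the linear terms cancel when the two instances of
    \<open>mul_ln_gap\<close> are added, and only the convexity gap remains.\<close>
  have "2 * (s * ln s) = (a + b) * ln s" unfolding ab by (simp only: mult.assoc)
  then have "(sqrt a - sqrt s)\<^sup>2 + (sqrt b - sqrt s)\<^sup>2 \<le> G"
    using mul_ln_gap[OF assms(1) s] mul_ln_gap[OF assms(2) s] ab unfolding G_def distrib_right by linarith
  then have G: "(sqrt a - sqrt s)\<^sup>2 \<le> G" using zero_le_power2[of "sqrt b - sqrt s"] by linarith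
  let ?x = "\<bar>sqrt a - sqrt s\<bar>" and ?y = "sqrt a + sqrt s"
  have "\<bar>a - b\<bar> = 2 * \<bar>a - s\<bar>" by (auto simp: s_def abs_if field_simps)
  also have "a - s = (sqrt a - sqrt s) * ?y" using assms s by (simp add: algebra_simps)
  also have "2 * \<bar>(sqrt a - sqrt s) * ?y\<bar> = 2 * (?x * ?y)" using assms s by (simp add: abs_mult)
  \<comment> \<open>Weighted AM-GM. The free parameter \<open>t\<close> balances gap against mass;
    \<open>almost_minimisers_close\<close> takes it to be the square root of the error
    level.\<close>
  also have "\<dots> \<le> ?x\<^sup>2 / t + t * ?y\<^sup>2"
  proof -
    have "0 \<le> (?x - t * ?y)\<^sup>2 / t" using assms by simp
    also have "\<dots> = ?x\<^sup>2 / t + t * ?y\<^sup>2 - 2 * (?x * ?y)"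
      using assms by (simp add: power2_eq_square field_simps)
    finally show ?thesis by simp
  qed
  also have "\<dots> \<le> G / t + 3 * t * (a + b)"
  proof (rule add_mono)
    show "?x\<^sup>2 / t \<le> G / t" using G assms by (simp add: divide_right_mono)
    have "?y\<^sup>2 \<le> 2 * (a + s)"
      using zero_le_power2[of "sqrt a - sqrt s"] assms s by (simp add: power2_eq_square algebra_simps)
    \<comment> \<open>Here 2 (a + s) = 3 a + b, hence the factor 3.\<close>
    also have "\<dots> \<le> 3 * (a + b)" using assms by (simp add: s_def)
    finally show "t * ?y\<^sup>2 \<le> 3 * t * (a + b)" using assms by (simp add: mult_left_mono)
  qed
  finally show ?thesis by (simp add: G_def s_def)
qed

subsection \<open>Convergence in mean and lower semicontinuity of energies\<close>

text \<open>Upper bounds \<open>l n\<close> stand in for the integrals themselves, so that a term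
  which is merely bounded along the sequence can be replaced by its bound.\<close>

lemma integrable_Fatou_real:
  fixes F :: "'a \<Rightarrow> real"
  assumes int: "\<And>n. integrable M (Fn n)" and nn: "\<And>n. AE x in M. 0 \<le> Fn n x"
    and le: "\<And>n. (\<integral>x. Fn n x \<partial>M) \<le> l n" and l: "l \<longlonglongrightarrow> L"
    and lim: "AE x in M. (\<lambda>n. Fn n x) \<longlonglongrightarrow> F x" and [measurable]: "F \<in> borel_measurable M"
  shows "integrable M F \<and> (\<integral>x. F x \<partial>M) \<le> L"
proof -
  have [measurable]: "Fn n \<in> borel_measurable M" for n using int by auto
  have nn': "AE x in M. \<forall>n. 0 \<le> Fn n x" using nn by (simp add: AE_all_countable)
  have F0: "AE x in M. 0 \<le> F x"
    using nn' lim by eventually_elim (rule LIMSEQ_le_const, auto)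
  have l0: "0 \<le> l n" for n using integral_nonneg_AE[OF nn[of n]] le[of n] by linarith
  then have L0: "0 \<le> L" using l by (intro LIMSEQ_le_const[OF l]) auto
  have "(\<integral>\<^sup>+x. ennreal (F x) \<partial>M) = (\<integral>\<^sup>+x. liminf (\<lambda>n. ennreal (Fn n x)) \<partial>M)"
  proof (rule nn_integral_cong_AE)
    show "AE x in M. ennreal (F x) = liminf (\<lambda>n. ennreal (Fn n x))"
      using lim by eventually_elim (metis lim_imp_Liminf sequentially_bot tendsto_ennrealI)
  qed
  also have "\<dots> \<le> liminf (\<lambda>n. \<integral>\<^sup>+x. ennreal (Fn n x) \<partial>M)" by (rule nn_integral_liminf) simp
  also have "\<dots> \<le> liminf (\<lambda>n. ennreal (l n))"
    by (intro Liminf_mono always_eventually allI)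
      (simp add: nn_integral_eq_integral[OF int nn] le ennreal_leI)
  also have "\<dots> = ennreal L" by (metis l lim_imp_Liminf sequentially_bot tendsto_ennrealI)
  finally have *: "(\<integral>\<^sup>+x. ennreal (F x) \<partial>M) \<le> ennreal L" .
  have F: "integrable M F"
    by (rule integrableI_nonneg) (use F0 * in \<open>auto intro: le_less_trans\<close>)
  show ?thesis
    using F * L0 by (simp add: nn_integral_eq_integral[OF F F0])
qed

text \<open>Summable increments make the telescoping series converge absolutely almost everywhere,
  so the full sequence converges and no subsequence is extracted. Plans and their marginals can thus
  be treated along the same index.\<close>

lemma L1_fast_Cauchy_converges:
  fixes h :: "nat \<Rightarrow> 'a \<Rightarrow> real"
  assumes int: "\<And>n. integrable M (h n)"
    and fast: "\<And>n. (\<integral>x. \<bar>h (Suc n) x - h n x\<bar> \<partial>M) \<le> (1/2) ^ n"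
  obtains k where "integrable M k" "AE x in M. (\<lambda>n. h n x) \<longlonglongrightarrow> k x"
    "(\<lambda>n. \<integral>x. \<bar>k x - h n x\<bar> \<partial>M) \<longlonglongrightarrow> 0"
proof -
  have [measurable]: "h n \<in> borel_measurable M" for n using int by auto
  define d where "d n x = h (Suc n) x - h n x" for n x
  have di: "integrable M (d n)" for n unfolding d_def by (intro Bochner_Integration.integrable_diff int)
  have sm: "summable (\<lambda>n. \<integral>x. norm (d n x) \<partial>M)"
    by (rule summable_comparison_test[OF _ summable_geometric[of "1/2::real"]])
      (use fast in \<open>auto simp: d_def\<close>)
  have "(\<integral>\<^sup>+x. (\<Sum>n. ennreal (norm (d n x))) \<partial>M) = (\<Sum>n. \<integral>\<^sup>+x. ennreal (norm (d n x)) \<partial>M)"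
    by (rule nn_integral_suminf) (auto simp: d_def)
  also have "\<dots> = (\<Sum>n. ennreal (\<integral>x. norm (d n x) \<partial>M))"
    by (intro suminf_cong nn_integral_eq_integral integrable_norm di) auto
  also have "\<dots> < \<infinity>" using sm by (simp add: less_top ennreal_suminf_neq_top)
  finally have "(\<integral>\<^sup>+x. (\<Sum>n. ennreal (norm (d n x))) \<partial>M) < \<infinity>" .
  then have "AE x in M. (\<Sum>n. ennreal (norm (d n x))) \<noteq> \<infinity>"
    by (intro nn_integral_PInf_AE) (auto simp: d_def less_top)
  then have ae: "AE x in M. summable (\<lambda>n. norm (d n x))"
    by eventually_elim (rule summable_suminf_not_top, simp_all)
  define k where "k x = h 0 x + (\<Sum>n. d n x)" for x
  have ki: "integrable M k"
    unfolding k_def by (intro Bochner_Integration.integrable_add int integrable_suminf[OF di ae sm])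
  have conv: "AE x in M. (\<lambda>n. h n x) \<longlonglongrightarrow> k x"
    using ae
  proof eventually_elim
    case (elim x)
    then have "(\<lambda>n. \<Sum>i<n. d i x) \<longlonglongrightarrow> (\<Sum>n. d n x)"
      by (rule summable_LIMSEQ[OF summable_norm_cancel])
    moreover have "(\<Sum>i<n. d i x) = h n x - h 0 x" for n
      unfolding d_def by (rule sum_lessThan_telescope)
    ultimately have "(\<lambda>n. h 0 x + (h n x - h 0 x)) \<longlonglongrightarrow> h 0 x + (\<Sum>n. d n x)"
      by (intro tendsto_add) auto
    then show ?case by (simp add: k_def)
  qed
  \<comment> \<open>The subtracted term is what lets the induction close; the bound 2 (1/2)^n alone
    would not reproduce itself.\<close>
  have dist: "(\<integral>x. \<bar>h (n + j) x - h n x\<bar> \<partial>M) \<le> 2 * (1/2) ^ n - 2 * (1/2) ^ (n + j)" for n j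
  proof (induction j)
    case (Suc j)
    have "(\<integral>x. \<bar>h (n + Suc j) x - h n x\<bar> \<partial>M)
        \<le> (\<integral>x. \<bar>h (Suc (n + j)) x - h (n + j) x\<bar> + \<bar>h (n + j) x - h n x\<bar> \<partial>M)"
      by (intro integral_mono integrable_abs Bochner_Integration.integrable_add Bochner_Integration.integrable_diff int) auto
    also have "\<dots> = (\<integral>x. \<bar>h (Suc (n + j)) x - h (n + j) x\<bar> \<partial>M) + (\<integral>x. \<bar>h (n + j) x - h n x\<bar> \<partial>M)"
      by (intro Bochner_Integration.integral_add integrable_abs Bochner_Integration.integrable_diff int)
    also have "\<dots> \<le> (1/2) ^ (n + j) + (2 * (1/2) ^ n - 2 * (1/2) ^ (n + j))"
      using fast Suc by (intro add_mono) auto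
    finally show ?case by simp
  qed simp
  \<comment> \<open>Fatou in \<open>j\<close> turns the Cauchy estimate into a distance to the
    limit.\<close>
  have bd: "(\<integral>x. \<bar>k x - h n x\<bar> \<partial>M) \<le> 2 * (1/2) ^ n" for n
  proof (rule integrable_Fatou_real[THEN conjunct2])
    show "AE x in M. (\<lambda>j. \<bar>h (n + j) x - h n x\<bar>) \<longlonglongrightarrow> \<bar>k x - h n x\<bar>"
      using conv
    proof eventually_elim
      case (elim x)
      then have "(\<lambda>j. h (n + j) x) \<longlonglongrightarrow> k x" using LIMSEQ_ignore_initial_segment[of _ _ n] by (simp add: add.commute)
      then show ?case by (intro tendsto_intros)
    qed
    show "(\<integral>x. \<bar>h (n + j) x - h n x\<bar> \<partial>M) \<le> 2 * (1/2) ^ n" for j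
      using dist[of n j] by (smt (verit) zero_le_power divide_nonneg_nonneg)
    show "(\<lambda>x. \<bar>k x - h n x\<bar>) \<in> borel_measurable M"
      using borel_measurable_integrable[OF ki] by measurable
    show "integrable M (\<lambda>x. \<bar>h (n + j) x - h n x\<bar>)" for j
      by (intro integrable_abs Bochner_Integration.integrable_diff int)
  qed auto
  have "(\<lambda>n. \<integral>x. \<bar>k x - h n x\<bar> \<partial>M) \<longlonglongrightarrow> 0"
  proof (rule tendsto_sandwich[where f = "\<lambda>_. 0" and h = "\<lambda>n. 2 * (1/2) ^ n"])
    show "(\<lambda>n. 2 * (1/2::real) ^ n) \<longlonglongrightarrow> 0"
      using tendsto_mult_right_zero[OF LIMSEQ_power_zero[of "1/2::real"], of 2] by simp
  qed (use bd in \<open>auto intro: always_eventually\<close>)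
  with ki conv show ?thesis by (rule that)
qed

section \<open>Convex energies with a sublinear lower bound\<close>

text \<open>The lower growth bound makes the negative part of \<open>\<Phi> \<circ> r\<close> integrable, on an \<open>n\<close>-dimensional
  space, for every density \<open>r\<close> with finite second moment.\<close>

definition energy_integrand :: "nat \<Rightarrow> (real \<Rightarrow> real) \<Rightarrow> bool" where
  "energy_integrand n \<Phi> \<longleftrightarrow>
     \<Phi> 0 = 0 \<and> continuous_on {0..} \<Phi> \<and>
     (\<forall>s\<ge>0. \<forall>t\<ge>0. \<Phi> ((s + t) / 2) \<le> (\<Phi> s + \<Phi> t) / 2) \<and>
     (\<exists>K\<ge>0. \<exists>a. real n / (real n + 2) < a \<and> a < 1 \<and> (\<forall>s\<ge>0. - (K * s powr a) \<le> \<Phi> s))"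

text \<open>The weight puts mass and second moment into one integrability condition. Nonnegativity
  is demanded at every point because an energy density is controlled only on the half-line.\<close>

definition moment_fun :: "('a::euclidean_space \<Rightarrow> real) \<Rightarrow> bool" where
  "moment_fun r \<longleftrightarrow> r \<in> borel_measurable borel \<and> (\<forall>x. 0 \<le> r x) \<and> integrable lborel (\<lambda>x. mweight x * r x)"

lemma moment_funD:
  assumes "moment_fun r"
  shows "r \<in> borel_measurable borel" "\<And>x. 0 \<le> r x" "integrable lborel (\<lambda>x. mweight x * r x)"
    "integrable lborel r"
proof -
  show 1: "r \<in> borel_measurable borel" "\<And>x. 0 \<le> r x" "integrable lborel (\<lambda>x. mweight x * r x)"
    using assms by (auto simp: moment_fun_def)
  show "integrable lborel r"
    by (rule Bochner_Integration.integrable_bound[OF 1(3)]) (use 1 in \<open>auto simp: abs_mult mult_left_le_one_le distrib_right\<close>)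
qed

lemma energy_integrand_measurable:
  assumes "energy_integrand n \<Phi>" "r \<in> borel_measurable M" "\<And>x. 0 \<le> r x"
  shows "(\<lambda>x. \<Phi> (r x)) \<in> borel_measurable M"
proof -
  have "continuous_on {0..} \<Phi>" using assms by (simp add: energy_integrand_def)
  then have "(\<lambda>s. if s \<in> {0..} then \<Phi> s else 0) \<in> borel_measurable borel"
    by (intro borel_measurable_continuous_on_if) auto
  from measurable_compose[OF assms(2) this] show ?thesis using assms(3) by simp
qed

text \<open>The condition a > n/(n+2) is equivalent to n < 2 a/(1-a), which makes the remainder of
  \<open>powr_le_weighted\<close> integrable. The coefficient \<delta> stays free so that the moment
  can be absorbed later.\<close>

lemma energy_integrand_lower:
  assumes E: "energy_integrand DIM('a::euclidean_space) \<Phi>" and "0 < \<delta>"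
  obtains q :: "'a::euclidean_space \<Rightarrow> real" where "integrable lborel q" "\<And>x. 0 \<le> q x"
    "\<And>x s. 0 \<le> s \<Longrightarrow> 0 \<le> \<Phi> s + \<delta> * (mweight x * s) + q x"
proof -
  let ?n = "real DIM('a)"
  obtain K a where K: "0 \<le> K" and a: "?n / (?n + 2) < a" "a < 1" and lo: "\<And>s. 0 \<le> s \<Longrightarrow> - (K * s powr a) \<le> \<Phi> s"
    using E unfolding energy_integrand_def by blast
  have a0: "0 < a" using a(1) by (smt (verit) divide_nonneg_nonneg of_nat_0_le_iff)
  have "?n < a * (?n + 2)" using a(1) by (simp add: divide_less_eq mult.commute add_pos_nonneg)
  then have b: "?n < 2 * (a / (1 - a))" using a(2) by (simp add: field_simps)
  obtain Q where Q: "0 \<le> Q" "\<And>s w. 0 \<le> s \<Longrightarrow> 0 < w \<Longrightarrow> K * s powr a \<le> \<delta> * w * s + Q * w powr (- (a / (1 - a)))"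
    using powr_le_weighted[OF a0 a(2) K \<open>0 < \<delta>\<close>] by blast
  show ?thesis
  proof
    show "integrable lborel (\<lambda>x::'a. Q * mweight x powr (- (a / (1 - a))))"
      using integrable_mweight_powr[OF b] by auto
    show "0 \<le> Q * mweight x powr (- (a / (1 - a)))" for x :: 'a using Q by simp
    show "0 \<le> \<Phi> s + \<delta> * (mweight x * s) + Q * mweight x powr (- (a / (1 - a)))" if "0 \<le> s" for x :: 'a and s
      using Q(2)[OF that mweight_pos[of x]] lo[OF that] by (simp add: mult.assoc)
  qed
qed

text \<open>\<open>Q\<close> depends on \<delta> but not on \<open>r\<close>; this uniformity is
  what bounds the functional from below.\<close>

lemma energy_integral_lower:
  assumes E: "energy_integrand DIM('a::euclidean_space) \<Phi>" and "0 < \<delta>"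
  obtains Q where "\<And>r :: 'a::euclidean_space \<Rightarrow> real. moment_fun r \<Longrightarrow> integrable lborel (\<lambda>x. \<Phi> (r x)) \<Longrightarrow>
     - \<delta> * (\<integral>x. mweight x * r x \<partial>lborel) - Q \<le> (\<integral>x. \<Phi> (r x) \<partial>lborel)"
proof -
  obtain q :: "'a \<Rightarrow> real" where q: "integrable lborel q" "\<And>x. 0 \<le> q x"
    "\<And>x s. 0 \<le> s \<Longrightarrow> 0 \<le> \<Phi> s + \<delta> * (mweight x * s) + q x"
    using energy_integrand_lower[OF assms] by blast
  have "- \<delta> * (\<integral>x. mweight x * r x \<partial>lborel) - integral\<^sup>L lborel q \<le> (\<integral>x. \<Phi> (r x) \<partial>lborel)"
    if r: "moment_fun r" "integrable lborel (\<lambda>x. \<Phi> (r x))" for r :: "'a \<Rightarrow> real"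
  proof -
    note m = moment_funD[OF r(1)]
    have "0 \<le> (\<integral>x. \<Phi> (r x) + \<delta> * (mweight x * r x) + q x \<partial>lborel)"
      using q(3) m(2) by (intro integral_nonneg_AE) simp
    also have "\<dots> = (\<integral>x. \<Phi> (r x) \<partial>lborel) + \<delta> * (\<integral>x. mweight x * r x \<partial>lborel) + integral\<^sup>L lborel q"
      using q m r by simp
    finally show ?thesis by simp
  qed
  then show ?thesis using that by blast
qed

lemma energy_neg_part_finite:
  assumes E: "energy_integrand DIM('a::euclidean_space) \<Phi>" and r: "moment_fun (r :: 'a \<Rightarrow> real)"
  shows "(\<integral>\<^sup>+x. ennreal (- \<Phi> (r x)) \<partial>lborel) < \<infinity>"
proof -
  obtain q :: "'a \<Rightarrow> real" where q: "integrable lborel q" "\<And>x. 0 \<le> q x"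
    "\<And>x s. 0 \<le> s \<Longrightarrow> 0 \<le> \<Phi> s + 1 * (mweight x * s) + q x"
    using energy_integrand_lower[OF E, of 1] by auto
  note m = moment_funD[OF r]
  have "integrable lborel (\<lambda>x. mweight x * r x + q x)" by (intro Bochner_Integration.integrable_add q m)
  then have fin: "(\<integral>\<^sup>+x. ennreal (mweight x * r x + q x) \<partial>lborel) < \<infinity>"
    using q m by (subst nn_integral_eq_integral) auto
  have "(\<integral>\<^sup>+x. ennreal (- \<Phi> (r x)) \<partial>lborel) \<le> (\<integral>\<^sup>+x. ennreal (mweight x * r x + q x) \<partial>lborel)"
    using q(3) m(2) by (intro nn_integral_mono ennreal_leI) (smt (verit))
  from le_less_trans[OF this fin] show ?thesis .
qed

text \<open>With a finite negative part the difference in \<open>eintegral\<close> is never infinity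
  minus infinity, so failure of integrability can only mean the value +infinity.\<close>

lemma eintegral_eq:
  fixes g :: "'a \<Rightarrow> real"
  assumes g: "g \<in> borel_measurable M" and neg: "(\<integral>\<^sup>+x. ennreal (- g x) \<partial>M) < \<infinity>"
  shows "eintegral M g = (if integrable M g then ereal (integral\<^sup>L M g) else \<infinity>)"
proof (cases "integrable M g")
  case True
  have eq: "enn2ereal e = ereal (enn2real e)" if "e \<noteq> \<infinity>" for e
    using that by (cases e) (auto simp: enn2ereal_ennreal)
  have fin: "(\<integral>\<^sup>+x. ennreal (g x) \<partial>M) \<noteq> \<infinity>" "(\<integral>\<^sup>+x. ennreal (- g x) \<partial>M) \<noteq> \<infinity>"
    using True by (auto simp: real_integrable_def)
  show ?thesis using True unfolding eintegral_def eq[OF fin(1)] eq[OF fin(2)]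
    by (simp add: real_lebesgue_integral_def)
next
  case False
  have "(\<integral>\<^sup>+x. ennreal (g x) \<partial>M) = \<infinity>"
    using False g neg by (auto simp: real_integrable_def)
  then show ?thesis using False neg by (simp add: eintegral_def)
qed

lemma eintegral_nonneg_eq:
  fixes g :: "'a \<Rightarrow> real"
  assumes "g \<in> borel_measurable M" "\<And>x. 0 \<le> g x"
  shows "eintegral M g = (if integrable M g then ereal (integral\<^sup>L M g) else \<infinity>)"
  using assms by (intro eintegral_eq) (auto simp: ennreal_neg)

lemma eintegral_energy:
  assumes "energy_integrand DIM('a::euclidean_space) \<Phi>" "moment_fun (r :: 'a \<Rightarrow> real)"
  shows "eintegral lborel (\<lambda>x. \<Phi> (r x)) =
    (if integrable lborel (\<lambda>x. \<Phi> (r x)) then ereal (\<integral>x. \<Phi> (r x) \<partial>lborel) else \<infinity>)"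
proof (rule eintegral_eq)
  show "(\<lambda>x. \<Phi> (r x)) \<in> borel_measurable lborel"
    by (rule energy_integrand_measurable[OF assms(1)]) (use moment_funD[OF assms(2)] in simp_all)
qed (rule energy_neg_part_finite[OF assms])

text \<open>An added moment term restores the sign that Fatou's lemma needs. The moments stay
  bounded but need not converge, so they cost \<delta> B in the limit; since \<delta> is arbitrary,
  this error disappears.\<close>

lemma energy_lsc:
  fixes r :: "'a::euclidean_space \<Rightarrow> real"
  assumes E: "energy_integrand DIM('a) \<Phi>"
    and rn: "\<And>n. moment_fun (rn n)" "\<And>n. (\<integral>x. mweight x * rn n x \<partial>lborel) \<le> B"
    and int: "\<And>n. integrable lborel (\<lambda>x. \<Phi> (rn n x))" "\<And>n. (\<integral>x. \<Phi> (rn n x) \<partial>lborel) \<le> l n" "l \<longlonglongrightarrow> L"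
    and r: "moment_fun r" and lim: "AE x in lborel. (\<lambda>n. rn n x) \<longlonglongrightarrow> r x"
  shows "integrable lborel (\<lambda>x. \<Phi> (r x))" "(\<integral>x. \<Phi> (r x) \<partial>lborel) \<le> L"
proof -
  have *: "integrable lborel (\<lambda>x. \<Phi> (r x)) \<and> (\<integral>x. \<Phi> (r x) \<partial>lborel) \<le> L + \<delta> * B" if \<delta>: "0 < \<delta>" for \<delta>
  proof -
    obtain q :: "'a \<Rightarrow> real" where q: "integrable lborel q" "\<And>x. 0 \<le> q x"
      "\<And>x s. 0 \<le> s \<Longrightarrow> 0 \<le> \<Phi> s + \<delta> * (mweight x * s) + q x"
      using energy_integrand_lower[OF E \<delta>] by blast
    let ?F = "\<lambda>r x. \<Phi> (r x) + \<delta> * (mweight x * r x) + q x"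
    note m = moment_funD[OF r] and mn = moment_funD[OF rn(1)]
    have eq: "(\<integral>x. ?F r x \<partial>lborel) = (\<integral>x. \<Phi> (r x) \<partial>lborel) + \<delta> * (\<integral>x. mweight x * r x \<partial>lborel) + integral\<^sup>L lborel q"
      if "moment_fun r" "integrable lborel (\<lambda>x. \<Phi> (r x))" for r
      using q(1) moment_funD(3)[OF that(1)] that by simp
    have cont: "continuous_on {0..} \<Phi>" using E by (simp add: energy_integrand_def)
    have F: "integrable lborel (?F r) \<and>
      (\<integral>x. ?F r x \<partial>lborel) \<le> L + \<delta> * B + integral\<^sup>L lborel q"
    proof (rule integrable_Fatou_real[where Fn = "\<lambda>n. ?F (rn n)" and l = "\<lambda>n. l n + \<delta> * B + integral\<^sup>L lborel q"])
      show "integrable lborel (?F (rn n))" for n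
        by (intro Bochner_Integration.integrable_add integrable_mult_right q mn int)
      show "AE x in lborel. 0 \<le> ?F (rn n) x" for n using q(3) mn(2) by simp
      show "(\<integral>x. ?F (rn n) x \<partial>lborel) \<le> l n + \<delta> * B + integral\<^sup>L lborel q" for n
        unfolding eq[OF rn(1) int(1)] using rn(2)[of n] int(2)[of n] \<delta> by (intro add_mono mult_left_mono) simp_all
      show "(\<lambda>n. l n + \<delta> * B + integral\<^sup>L lborel q) \<longlonglongrightarrow> L + \<delta> * B + integral\<^sup>L lborel q"
        by (intro tendsto_intros int(3))
      show "AE x in lborel. (\<lambda>n. ?F (rn n) x) \<longlonglongrightarrow> ?F r x"
        using lim
      proof eventually_elim
        case (elim x)
        have "(\<lambda>n. \<Phi> (rn n x)) \<longlonglongrightarrow> \<Phi> (r x)"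
          by (rule continuous_on_tendsto_compose[OF cont elim]) (use m(2) mn(2) in auto)
        then show ?case using elim by (intro tendsto_intros)
      qed
      have [measurable]: "(\<lambda>x. \<Phi> (r x)) \<in> borel_measurable lborel"
        by (rule energy_integrand_measurable[OF E]) (use m(1,2) in simp_all)
      have [measurable]: "q \<in> borel_measurable lborel" "(\<lambda>x. mweight x * r x) \<in> borel_measurable lborel"
        using q(1) m(3) by (auto dest: borel_measurable_integrable)
      show "?F r \<in> borel_measurable lborel" by measurable
    qed
    have "integrable lborel (\<lambda>x. ?F r x - \<delta> * (mweight x * r x) - q x)" by (intro Bochner_Integration.integrable_diff integrable_mult_right F[THEN conjunct1] q m)
    then have i: "integrable lborel (\<lambda>x. \<Phi> (r x))" by simp
    have "0 \<le> \<delta> * (\<integral>x. mweight x * r x \<partial>lborel)" using \<delta> m(2) by (intro mult_nonneg_nonneg integral_nonneg_AE) (auto simp: add_nonneg_nonneg)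
    then show ?thesis using i F[THEN conjunct2] eq[OF r i] by simp
  qed
  show "integrable lborel (\<lambda>x. \<Phi> (r x))" using *[of 1] by simp
  show "(\<integral>x. \<Phi> (r x) \<partial>lborel) \<le> L"
  proof (rule field_le_epsilon)
    fix e :: real assume "0 < e"
    define \<delta> where "\<delta> = e / (\<bar>B\<bar> + 1)"
    have "0 < \<delta>" "\<delta> * B \<le> e" using \<open>0 < e\<close> unfolding \<delta>_def by (auto simp: field_simps intro: order_trans[of _ "e * \<bar>B\<bar>"])
    then show "(\<integral>x. \<Phi> (r x) \<partial>lborel) \<le> L + e" using *[of \<delta>] by linarith
  qed
qed

lemma moment_fun_mid:
  assumes "moment_fun r" "moment_fun s"
  shows "moment_fun (\<lambda>x. (r x + s x) / 2)"
proof -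
  note m = moment_funD[OF assms(1)] moment_funD[OF assms(2)]
  have "integrable lborel (\<lambda>x. (mweight x * r x + mweight x * s x) / 2)"
    by (intro integrable_divide_zero Bochner_Integration.integrable_add m)
  then have "integrable lborel (\<lambda>x. mweight x * ((r x + s x) / 2))" by (simp add: distrib_left)
  moreover have "(\<lambda>x. (r x + s x) / 2) \<in> borel_measurable borel" using m(1,5) by measurable
  ultimately show ?thesis using m(2,6) by (simp add: moment_fun_def)
qed

lemma energy_mid_integrable:
  fixes r s :: "'a::euclidean_space \<Rightarrow> real"
  assumes E: "energy_integrand DIM('a) \<Phi>" and r: "moment_fun r" "integrable lborel (\<lambda>x. \<Phi> (r x))"
    and s: "moment_fun s" "integrable lborel (\<lambda>x. \<Phi> (s x))"
  shows "integrable lborel (\<lambda>x. \<Phi> ((r x + s x) / 2))"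
    "(\<integral>x. \<Phi> ((r x + s x) / 2) \<partial>lborel) \<le> ((\<integral>x. \<Phi> (r x) \<partial>lborel) + (\<integral>x. \<Phi> (s x) \<partial>lborel)) / 2"
proof -
  note t = moment_funD[OF moment_fun_mid[OF r(1) s(1)]] and rm = moment_funD[OF r(1)] and sm = moment_funD[OF s(1)]
  obtain q :: "'a \<Rightarrow> real" where q: "integrable lborel q" "\<And>x. 0 \<le> q x"
    "\<And>x s. 0 \<le> s \<Longrightarrow> 0 \<le> \<Phi> s + 1 * (mweight x * s) + q x"
    using energy_integrand_lower[OF E, of 1] by auto
  have mid: "\<Phi> ((r x + s x) / 2) \<le> (\<Phi> (r x) + \<Phi> (s x)) / 2" for x
    using E rm(2) sm(2) unfolding energy_integrand_def by blast
  show i: "integrable lborel (\<lambda>x. \<Phi> ((r x + s x) / 2))"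
  proof (rule Bochner_Integration.integrable_bound)
    \<comment> \<open>Convexity bounds the midpoint energy from above and the Young bound controls
      it from below; this sum dominates both.\<close>
    show "integrable lborel (\<lambda>x. \<bar>(\<Phi> (r x) + \<Phi> (s x)) / 2\<bar> + mweight x * ((r x + s x) / 2) + q x)"
      by (intro Bochner_Integration.integrable_add integrable_abs integrable_divide_zero r s q t)
    show "(\<lambda>x. \<Phi> ((r x + s x) / 2)) \<in> borel_measurable lborel"
      by (rule energy_integrand_measurable[OF E]) (use t in auto)
    show "AE x in lborel. norm (\<Phi> ((r x + s x) / 2)) \<le> norm (\<bar>(\<Phi> (r x) + \<Phi> (s x)) / 2\<bar> + mweight x * ((r x + s x) / 2) + q x)"
    proof (intro AE_I2)
      fix x :: 'a
      have "0 \<le> mweight x * ((r x + s x) / 2)"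
        by (rule mult_nonneg_nonneg[OF less_imp_le[OF mweight_pos] t(2)])
      then show "norm (\<Phi> ((r x + s x) / 2)) \<le> norm (\<bar>(\<Phi> (r x) + \<Phi> (s x)) / 2\<bar> + mweight x * ((r x + s x) / 2) + q x)"
        using q(3)[OF t(2)[of x], of x] q(2)[of x] mid[of x] unfolding real_norm_def by linarith
    qed
  qed
  have "(\<integral>x. \<Phi> ((r x + s x) / 2) \<partial>lborel) \<le> (\<integral>x. (\<Phi> (r x) + \<Phi> (s x)) / 2 \<partial>lborel)"
    by (intro integral_mono i mid integrable_divide_zero Bochner_Integration.integrable_add r s)
  then show "(\<integral>x. \<Phi> ((r x + s x) / 2) \<partial>lborel) \<le> ((\<integral>x. \<Phi> (r x) \<partial>lborel) + (\<integral>x. \<Phi> (s x) \<partial>lborel)) / 2"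
    using r s by simp
qed

text \<open>Every exponent below one is available: the bound ln t <= t at t = s^(a-1) gives s ln s
  >= - s^a / (1-a). So the threshold can be met in every dimension, in particular on the product
  space.\<close>

lemma energy_integrand_entropy: "energy_integrand n (\<lambda>s. s * ln s)"
proof -
  let ?\<Phi> = "\<lambda>s::real. s * ln s"
  have "real n / (real n + 2) < 1" by (simp add: divide_less_eq)
  then obtain a where a: "real n / (real n + 2) < a" "a < 1" using dense by blast
  have a0: "0 < a" using a(1) by (smt (verit) divide_nonneg_nonneg of_nat_0_le_iff)
  have lo: "- (1 / (1 - a) * s powr a) \<le> s * ln s" if "0 \<le> s" for s
  proof (cases "s = 0")
    case False
    then have s: "0 < s" using that by simp
    have "ln (s powr (a - 1)) \<le> s powr (a - 1)" using s by (intro order_trans[OF ln_le_minus_one]) auto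
    then have "(a - 1) * ln s \<le> s powr (a - 1)" using s by (simp add: ln_powr)
    then have "s * ((a - 1) * ln s) \<le> s * s powr (a - 1)" using s by (intro mult_left_mono) auto
    also have "\<dots> = s powr a" using s powr_add[of s 1 "a - 1"] by simp
    finally show ?thesis using a by (simp add: field_simps)
  qed (use a0 in simp)
  have mid: "?\<Phi> ((s + t) / 2) \<le> (?\<Phi> s + ?\<Phi> t) / 2" if "0 \<le> s" "0 \<le> t" for s t
  proof (cases "s + t = 0")
    case True
    then have "s = 0" "t = 0" using that by auto
    then show ?thesis by simp
  next
    case False
    define r where "r = (s + t) / 2"
    have st: "s + t = 2 * r" and r: "0 < r" using False that by (auto simp: r_def)
    have "2 * (r * ln r) = (s + t) * ln r" unfolding st by (simp only: mult.assoc)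
    then show ?thesis
      using mul_ln_gap[OF that(1) r] mul_ln_gap[OF that(2) r] zero_le_power2[of "sqrt s - sqrt r"]
        zero_le_power2[of "sqrt t - sqrt r"] st unfolding r_def[symmetric] distrib_right by argo
  qed
  have "continuous_on {0..} ?\<Phi>"
    unfolding continuous_on_def
  proof (rule ballI)
    fix x :: real assume "x \<in> {0..}"
    show "((\<lambda>s. s * ln s) \<longlongrightarrow> x * ln x) (at x within {0..})"
    proof (cases "x = 0")
      case True
      \<comment> \<open>At 0 the function is squeezed between its growth bound and s^2.\<close>
      have u: "((\<lambda>s. - (1 / (1 - a) * s powr a)) \<longlongrightarrow> - (1 / (1 - a) * 0 powr a)) (at 0 within {0..})"
        using a0 by (intro tendsto_intros tendsto_powr') (auto simp: eventually_at_filter)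
      have v: "((\<lambda>s::real. s * s) \<longlongrightarrow> 0 * 0) (at 0 within {0..})" by (intro tendsto_intros)
      have "((\<lambda>s::real. s * ln s) \<longlongrightarrow> 0) (at 0 within {0..})"
      proof (rule tendsto_sandwich[where f = "\<lambda>s. - (1 / (1 - a) * s powr a)" and h = "\<lambda>s. s * s"])
        show "\<forall>\<^sub>F s in at 0 within {0..}. - (1 / (1 - a) * s powr a) \<le> s * ln s"
          unfolding eventually_at_filter using lo by auto
        have "s * ln s \<le> s * s" if "0 \<le> s" for s :: real
          using that ln_le_minus_one[of s] by (cases "s = 0") (auto intro!: mult_left_mono)
        then show "\<forall>\<^sub>F s in at (0::real) within {0..}. s * ln s \<le> s * s"
          unfolding eventually_at_filter by (auto intro!: always_eventually)
      qed (use u v in auto)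
      then show ?thesis using True by simp
    next
      case False
      then show ?thesis using \<open>x \<in> {0..}\<close> by (intro tendsto_intros) auto
    qed
  qed
  with a lo mid show ?thesis unfolding energy_integrand_def
    by (intro conjI exI[of _ "1 / (1 - a)"] exI[of _ a]) auto
qed

subsection \<open>Densities, marginals and couplings\<close>

definition prob_density :: "('a::euclidean_space \<Rightarrow> real) \<Rightarrow> bool" where
  "prob_density g \<longleftrightarrow> moment_fun g \<and> (\<integral>x. g x \<partial>lborel) = 1"

abbreviation dmeasure :: "('a::euclidean_space \<Rightarrow> real) \<Rightarrow> 'a measure" where
  "dmeasure g \<equiv> density lborel (\<lambda>x. ennreal (g x))"

lemma prob_densityD:
  assumes "prob_density g"
  shows "moment_fun g" "(\<integral>x. g x \<partial>lborel) = 1" "g \<in> borel_measurable borel" "\<And>x. 0 \<le> g x"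
    "integrable lborel (\<lambda>x. mweight x * g x)" "integrable lborel g"
  using assms moment_funD[of g] by (simp_all add: prob_density_def)

lemma second_moment_finite_iff:
  assumes "sets \<rho> = sets borel"
  shows "second_moment \<rho> < \<infinity> \<longleftrightarrow> (\<integral>\<^sup>+x. ennreal ((norm x)\<^sup>2) \<partial>\<rho>) < \<infinity>"
proof -
  have "(\<integral>\<^sup>+x. ennreal (- (norm x)\<^sup>2) \<partial>\<rho>) = 0" by (simp add: ennreal_neg)
  then have "second_moment \<rho> = enn2ereal (\<integral>\<^sup>+x. ennreal ((norm x)\<^sup>2) \<partial>\<rho>)"
    by (simp add: second_moment_def eintegral_def zero_ennreal.rep_eq)
  then show ?thesis by (simp add: less_ennreal.rep_eq)
qed

text \<open>The measure is sigma-finite, so its Radon-Nikodym derivative is finite almost everywhere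
  and nothing is lost when \<open>dens\<close> makes it real. Together with
  \<open>dmeasure_P2r\<close> this lets the variational argument work with functions alone.\<close>

lemma P2r_dens:
  fixes \<rho> :: "'a::euclidean_space measure"
  assumes "\<rho> \<in> P2r"
  shows "dmeasure (dens \<rho>) = \<rho>" "prob_density (dens \<rho>)"
proof -
  have p: "prob_space \<rho>" and st: "sets \<rho> = sets borel" and sm: "second_moment \<rho> < \<infinity>"
    and ac: "absolutely_continuous lborel \<rho>"
    using assms by (auto simp: P2r_def P2_def)
  interpret prob_space \<rho> by fact
  have st': "sets \<rho> = sets lborel" using st by simp
  have fin: "AE x in lborel. RN_deriv lborel \<rho> x \<noteq> \<infinity>"
    by (rule sigma_finite_measure.RN_deriv_finite[OF sigma_finite_lborel sigma_finite_measure_axioms ac st'])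
  have meas: "dens \<rho> \<in> borel_measurable borel"
    unfolding dens_def[abs_def] using borel_measurable_RN_deriv[of lborel \<rho>] by simp
  have "density lborel (\<lambda>x. ennreal (dens \<rho> x)) = density lborel (RN_deriv lborel \<rho>)"
  proof (rule density_cong)
    show "AE x in lborel. ennreal (dens \<rho> x) = RN_deriv lborel \<rho> x"
      using fin by eventually_elim (simp add: dens_def less_top)
  qed (use meas in simp_all)
  then show eq: "dmeasure (dens \<rho>) = \<rho>" using sigma_finite_measure.density_RN_deriv[OF sigma_finite_lborel ac st'] by simp
  have nn: "0 \<le> dens \<rho> x" for x by (simp add: dens_def)
  have one: "(\<integral>\<^sup>+x. ennreal (dens \<rho> x) \<partial>lborel) = 1"
  proof -
    have "emeasure (dmeasure (dens \<rho>)) UNIV = 1"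
      using emeasure_space_1 sets_eq_imp_space_eq[OF st] by (simp add: eq)
    then show ?thesis using meas by (simp add: emeasure_density)
  qed
  from one have int: "integrable lborel (dens \<rho>)"
    by (intro integrableI_nonneg) (use meas nn in simp_all)
  have i1: "(\<integral>x. dens \<rho> x \<partial>lborel) = 1"
    using one nn_integral_eq_integral[OF int] nn by simp
  have "(\<integral>\<^sup>+x. ennreal ((norm x)\<^sup>2) \<partial>dmeasure (dens \<rho>)) < \<infinity>"
    using sm second_moment_finite_iff[OF st] by (simp add: eq)
  then have "(\<integral>\<^sup>+x. ennreal (dens \<rho> x) * ennreal ((norm x)\<^sup>2) \<partial>lborel) < \<infinity>"
    using meas by (subst (asm) nn_integral_density) simp_all
  then have "(\<integral>\<^sup>+x. ennreal ((norm x)\<^sup>2 * dens \<rho> x) \<partial>lborel) < \<infinity>"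
    by (simp add: ennreal_mult nn mult.commute)
  then have "integrable lborel (\<lambda>x. (norm x)\<^sup>2 * dens \<rho> x)"
    by (intro integrableI_nonneg) (use meas nn in simp_all)
  then have "integrable lborel (\<lambda>x. dens \<rho> x + (norm x)\<^sup>2 * dens \<rho> x)"
    by (intro Bochner_Integration.integrable_add int)
  then have "integrable lborel (\<lambda>x. mweight x * dens \<rho> x)" by (simp add: distrib_right)
  then show "prob_density (dens \<rho>)" using meas nn i1 by (simp add: prob_density_def moment_fun_def)
qed

lemma prob_space_dmeasure:
  assumes "prob_density g" shows "prob_space (dmeasure g)"
proof
  note g = prob_densityD[OF assms]
  show "emeasure (dmeasure g) (space (dmeasure g)) = 1"
    using g by (simp add: emeasure_density nn_integral_eq_integral)
qed

lemma dmeasure_P2r: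
  fixes g :: "'a::euclidean_space \<Rightarrow> real"
  assumes "prob_density g"
  shows "dmeasure g \<in> P2r" "AE x in lborel. dens (dmeasure g) x = g x"
proof -
  note g = prob_densityD[OF assms]
  have [measurable]: "g \<in> borel_measurable borel" by (rule g)
  have "(\<integral>\<^sup>+x. ennreal ((norm x)\<^sup>2) \<partial>dmeasure g) = (\<integral>\<^sup>+x. ennreal (g x * (norm x)\<^sup>2) \<partial>lborel)"
    using g(4) by (subst nn_integral_density) (simp_all add: ennreal_mult)
  also have "\<dots> \<le> (\<integral>\<^sup>+x. ennreal (mweight x * g x) \<partial>lborel)"
    using g(4) by (intro nn_integral_mono ennreal_leI) (simp add: algebra_simps)
  also have "\<dots> = ennreal (\<integral>x. mweight x * g x \<partial>lborel)"
    using g(4) by (intro nn_integral_eq_integral[OF g(5)]) simp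
  finally have "(\<integral>\<^sup>+x. ennreal ((norm x)\<^sup>2) \<partial>dmeasure g) < \<infinity>"
    by (simp add: le_less_trans)
  then have "second_moment (dmeasure g) < \<infinity>" by (subst second_moment_finite_iff) simp_all
  then show "dmeasure g \<in> P2r"
    using prob_space_dmeasure[OF assms] by (simp add: P2r_def P2_def absolutely_continuousI_density)
  have "AE x in lborel. ennreal (g x) = RN_deriv lborel (dmeasure g) x"
    by (rule sigma_finite_measure.RN_deriv_unique[OF sigma_finite_lborel]) simp_all
  then show "AE x in lborel. dens (dmeasure g) x = g x"
    by eventually_elim (metis dens_def enn2real_ennreal g(4))
qed

lemma eintegral_cong_AE:
  assumes "AE x in M. f x = g x" shows "eintegral M f = eintegral M g"
proof -
  have "(\<integral>\<^sup>+x. ennreal (f x) \<partial>M) = (\<integral>\<^sup>+x. ennreal (g x) \<partial>M)"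
    by (rule nn_integral_cong_AE) (use assms in eventually_elim, simp)
  moreover have "(\<integral>\<^sup>+x. ennreal (- f x) \<partial>M) = (\<integral>\<^sup>+x. ennreal (- g x) \<partial>M)"
    by (rule nn_integral_cong_AE) (use assms in eventually_elim, simp)
  ultimately show ?thesis by (simp add: eintegral_def)
qed

lemma eintegral_lborel_dens:
  fixes g :: "'a::euclidean_space \<Rightarrow> real" and F :: "'a \<Rightarrow> real \<Rightarrow> real"
  assumes "prob_density g"
  shows "eintegral lborel (\<lambda>x. F x (dens (dmeasure g) x)) = eintegral lborel (\<lambda>x. F x (g x))"
  by (rule eintegral_cong_AE) (use dmeasure_P2r(2)[OF assms] in eventually_elim, simp)

lemma integrable_moment_bound:
  fixes g c :: "'a::euclidean_space \<Rightarrow> real"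
  assumes g: "moment_fun g" and c: "c \<in> borel_measurable borel" "\<And>x. \<bar>c x\<bar> \<le> K * mweight x"
  shows "integrable lborel (\<lambda>x. c x * g x)"
proof (rule Bochner_Integration.integrable_bound)
  note m = moment_funD[OF g]
  show "integrable lborel (\<lambda>x. K * (mweight x * g x))" by (intro integrable_mult_right m)
  show "(\<lambda>x. c x * g x) \<in> borel_measurable lborel" using m(1) c(1) by simp
  show "AE x in lborel. norm (c x * g x) \<le> norm (K * (mweight x * g x))"
  proof (intro AE_I2)
    fix x :: 'a
    have "norm (c x * g x) = \<bar>c x\<bar> * g x" using m(2)[of x] by (simp add: abs_mult)
    also have "\<dots> \<le> (K * mweight x) * g x" by (rule mult_right_mono[OF c(2) m(2)])
    also have "\<dots> \<le> norm (K * (mweight x * g x))" by (simp add: mult.assoc)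
    finally show "norm (c x * g x) \<le> norm (K * (mweight x * g x))" .
  qed
qed

lemma eintegral_dmeasure:
  fixes g c :: "'a::euclidean_space \<Rightarrow> real"
  assumes g: "prob_density g" and c: "c \<in> borel_measurable borel" "\<And>x. 0 \<le> c x" "\<And>x. c x \<le> K * mweight x"
  shows "eintegral (dmeasure g) c = ereal (\<integral>x. c x * g x \<partial>lborel)"
proof -
  note m = prob_densityD[OF g]
  have i: "integrable lborel (\<lambda>x. g x * c x)"
    using integrable_moment_bound[OF m(1) c(1), of K] c(2,3) by (simp add: mult.commute)
  have "integrable (dmeasure g) c"
    using m(3,4) c(1) i by (subst integrable_density) simp_all
  moreover have "integral\<^sup>L (dmeasure g) c = (\<integral>x. c x * g x \<partial>lborel)"
    using m(3,4) c(1) by (subst integral_density) (simp_all add: mult.commute)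
  ultimately show ?thesis using c(1,2) by (subst eintegral_nonneg_eq) simp_all
qed

text \<open>Integrating against the original density avoids a density of the image measure, which
  need not exist for a general \<open>T\<close>.\<close>

lemma measure_distr_dmeasure:
  fixes g :: "'a::euclidean_space \<Rightarrow> real" and T :: "'a \<Rightarrow> 'b::euclidean_space"
  assumes g: "prob_density g" and T[measurable]: "T \<in> borel_measurable borel" and A[measurable]: "A \<in> sets borel"
  shows "emeasure (distr (dmeasure g) borel T) A = ennreal (\<integral>x. indicator A (T x) * g x \<partial>lborel)"
    and "integrable lborel (\<lambda>x. indicator A (T x) * g x)"
proof -
  note m = prob_densityD[OF g]
  have [measurable]: "g \<in> borel_measurable borel" by (rule m)
  show i: "integrable lborel (\<lambda>x. indicator A (T x) * g x)"
    by (rule Bochner_Integration.integrable_bound[OF m(6)]) (auto split: split_indicator)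
  have TA: "T -` A \<in> sets borel" using measurable_sets[OF T A] by simp
  have "emeasure (distr (dmeasure g) borel T) A = emeasure (dmeasure g) (T -` A)"
    by (subst emeasure_distr) simp_all
  also have "\<dots> = (\<integral>\<^sup>+x. ennreal (g x) * indicator (T -` A) x \<partial>lborel)"
    using TA by (intro emeasure_density) simp_all
  also have "\<dots> = (\<integral>\<^sup>+x. ennreal (indicator A (T x) * g x) \<partial>lborel)"
    by (intro nn_integral_cong) (simp split: split_indicator)
  also have "\<dots> = ennreal (\<integral>x. indicator A (T x) * g x \<partial>lborel)"
    using m(4) by (intro nn_integral_eq_integral i) simp
  finally show "emeasure (distr (dmeasure g) borel T) A = ennreal (\<integral>x. indicator A (T x) * g x \<partial>lborel)" .
qed

text \<open>The test function is an indicator, so pushing forward cannot increase the distance. This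
  stability lets marginal constraints pass to the limit.\<close>

lemma distr_dmeasure_L1:
  fixes g k :: "'a::euclidean_space \<Rightarrow> real" and T :: "'a \<Rightarrow> 'b::euclidean_space"
  assumes g: "prob_density g" and k: "prob_density k" and T: "T \<in> borel_measurable borel" and A: "A \<in> sets borel"
  shows "\<bar>measure (distr (dmeasure g) borel T) A - measure (distr (dmeasure k) borel T) A\<bar>
    \<le> (\<integral>x. \<bar>g x - k x\<bar> \<partial>lborel)"
proof -
  have m: "measure (distr (dmeasure g) borel T) A = (\<integral>x. indicator A (T x) * g x \<partial>lborel)"
    if "prob_density g" for g :: "'a \<Rightarrow> real"
    unfolding measure_def measure_distr_dmeasure(1)[OF that T A]
    using prob_densityD(4)[OF that] by (simp add: integral_nonneg_AE)
  note i = measure_distr_dmeasure(2)[OF _ T A]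
  have "\<bar>(\<integral>x. indicator A (T x) * g x \<partial>lborel) - (\<integral>x. indicator A (T x) * k x \<partial>lborel)\<bar>
     = \<bar>\<integral>x. indicator A (T x) * g x - indicator A (T x) * k x \<partial>lborel\<bar>"
    by (simp add: i g k)
  also have "\<dots> \<le> (\<integral>x. \<bar>indicator A (T x) * g x - indicator A (T x) * k x\<bar> \<partial>lborel)"
    by (rule integral_abs_bound)
  also have "\<dots> \<le> (\<integral>x. \<bar>g x - k x\<bar> \<partial>lborel)"
    by (intro integral_mono integrable_abs Bochner_Integration.integrable_diff i g k prob_densityD(6))
      (simp split: split_indicator)
  finally show ?thesis using m g k by simp
qed

text \<open>Serves twice: with \<open>fst\<close> the limit plan keeps the first marginal, with
  \<open>snd\<close> two minimisers coincide. The densities may depend on \<open>e\<close>, so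
  near-optimal plans suffice where no optimal one is known.\<close>

lemma distr_dmeasure_eqI:
  fixes T :: "'a::euclidean_space \<Rightarrow> 'b::euclidean_space"
  assumes "prob_space \<mu>" "prob_space \<nu>" "sets \<mu> = sets borel" "sets \<nu> = sets borel"
    and T: "T \<in> borel_measurable borel"
    and close: "\<And>e. 0 < e \<Longrightarrow> \<exists>g k. prob_density g \<and> prob_density k \<and> (\<integral>x. \<bar>g x - k x\<bar> \<partial>lborel) \<le> e \<and>
      distr (dmeasure g) borel T = \<mu> \<and> distr (dmeasure k) borel T = \<nu>"
  shows "\<mu> = \<nu>"
proof (rule measure_eqI)
  interpret M: prob_space \<mu> by fact
  interpret N: prob_space \<nu> by fact
  fix A assume "A \<in> sets \<mu>"
  then have A: "A \<in> sets borel" using assms by simp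
  have "\<bar>measure \<mu> A - measure \<nu> A\<bar> \<le> e" if e: "0 < e" for e
  proof -
    obtain g k where "prob_density g" "prob_density k" "(\<integral>x. \<bar>g x - k x\<bar> \<partial>lborel) \<le> e"
      "distr (dmeasure g) borel T = \<mu>" "distr (dmeasure k) borel T = \<nu>"
      using close[OF e] by blast
    then show ?thesis using distr_dmeasure_L1[of g k, OF _ _ T A] by simp
  qed
  then have "\<bar>measure \<mu> A - measure \<nu> A\<bar> \<le> 0" by (rule field_le_epsilon) simp
  then have "measure \<mu> A = measure \<nu> A" by simp
  then show "emeasure \<mu> A = emeasure \<nu> A" by (simp add: M.emeasure_eq_measure N.emeasure_eq_measure)
qed (use assms in simp)

text \<open>The Bochner integral is 0 where the section is not integrable. For integrable
  \<open>g\<close> this happens only on a null set, but identities such as additivity then hold only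
  almost everywhere.\<close>

definition marg :: "('a::euclidean_space \<times> 'a \<Rightarrow> real) \<Rightarrow> 'a \<Rightarrow> real" where
  "marg g y = (\<integral>x. g (x, y) \<partial>lborel)"

text \<open>Fubini against a test function of the second variable: the constant one gives the mass,
  \<open>mweight\<close> the moment and an indicator the law of the second coordinate.\<close>

lemma marg_test:
  fixes g :: "'a::euclidean_space \<times> 'a \<Rightarrow> real"
  assumes "integrable lborel (\<lambda>z. b (snd z) * g z)"
  shows "integrable lborel (\<lambda>y. b y * marg g y)" "(\<integral>y. b y * marg g y \<partial>lborel) = (\<integral>z. b (snd z) * g z \<partial>lborel)"
proof -
  have i: "integrable (lborel \<Otimes>\<^sub>M lborel) (case_prod (\<lambda>x y. b y * g (x, y)))"
    unfolding lborel_prod using assms by (simp add: case_prod_unfold)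
  have e: "(\<integral>x. b y * g (x, y) \<partial>lborel) = b y * marg g y" for y by (simp add: marg_def)
  show "integrable lborel (\<lambda>y. b y * marg g y)" using lborel_pair.integrable_snd[OF i] unfolding e .
  show "(\<integral>y. b y * marg g y \<partial>lborel) = (\<integral>z. b (snd z) * g z \<partial>lborel)"
    using lborel_pair.integral_snd[OF i] unfolding e lborel_prod by (simp add: case_prod_unfold)
qed

lemma norm_Pair_sq: "(norm (x, y))\<^sup>2 = (norm x)\<^sup>2 + (norm y)\<^sup>2"
  by (simp add: norm_Pair)

lemma mweight_snd_le: "mweight (snd z) \<le> mweight z" and mweight_fst_le: "mweight (fst z) \<le> mweight z"
  by (cases z; simp add: norm_Pair)+

lemma
  fixes g :: "'a::euclidean_space \<times> 'a \<Rightarrow> real"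
  assumes g: "prob_density g"
  shows prob_density_marg: "prob_density (marg g)"
    and marg_moment_le: "(\<integral>y. mweight y * marg g y \<partial>lborel) \<le> (\<integral>z. mweight z * g z \<partial>lborel)"
    and distr_snd_dmeasure: "distr (dmeasure g) borel snd = dmeasure (marg g)"
proof -
  note m = prob_densityD[OF g]
  have [measurable]: "g \<in> borel_measurable borel" by (rule m)
  have w: "integrable lborel (\<lambda>z. mweight (snd z) * g z)"
  proof (rule integrable_moment_bound[OF m(1), of _ 1])
    show "(\<lambda>z :: 'a \<times> 'a. mweight (snd z)) \<in> borel_measurable borel"
      by (intro borel_measurable_continuous_onI continuous_intros)
    show "\<bar>mweight (snd z)\<bar> \<le> 1 * mweight z" for z :: "'a \<times> 'a"
      using mweight_snd_le[of z] by (simp only: abs_of_pos[OF mweight_pos] mult_1)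
  qed
  note wm = marg_test[of mweight, OF w]
  have one: "integrable lborel (marg g)" "(\<integral>y. marg g y \<partial>lborel) = 1"
    using marg_test[of "\<lambda>_. 1" g] m by simp_all
  have nn: "0 \<le> marg g y" for y unfolding marg_def using m(4) by (simp add: integral_nonneg_AE)
  show p: "prob_density (marg g)"
    using one wm nn unfolding prob_density_def moment_fun_def by (simp add: borel_measurable_integrable[of lborel, simplified])
  show "(\<integral>y. mweight y * marg g y \<partial>lborel) \<le> (\<integral>z. mweight z * g z \<partial>lborel)"
    unfolding wm(2) by (intro integral_mono w m mult_right_mono mweight_snd_le)
  show "distr (dmeasure g) borel snd = dmeasure (marg g)"
  proof (rule measure_eqI)
    fix A assume "A \<in> sets (distr (dmeasure g) borel snd)"
    then have A: "A \<in> sets borel" by simp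
    have s: "(snd :: 'a \<times> 'a \<Rightarrow> 'a) \<in> borel_measurable borel" by (simp add: borel_measurable_continuous_onI continuous_on_snd)
    note d = measure_distr_dmeasure[OF g s A]
    have "distr (dmeasure (marg g)) borel (\<lambda>x. x) = dmeasure (marg g)" by (rule distr_id2) simp
    then have d': "emeasure (dmeasure (marg g)) A = ennreal (\<integral>y. indicator A y * marg g y \<partial>lborel)"
      using measure_distr_dmeasure(1)[OF p _ A, of "\<lambda>x. x"] by simp
    show "emeasure (distr (dmeasure g) borel snd) A = emeasure (dmeasure (marg g)) A"
      unfolding d(1) d' marg_test(2)[of "indicator A" g, OF d(2)] ..
  qed simp
qed

text \<open>Integrating out a variable contracts L1, so the marginals of a fast Cauchy sequence
  inherit its rate. The pointwise estimate holds where both sections are integrable.\<close>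

lemma marg_L1:
  fixes g k :: "'a::euclidean_space \<times> 'a \<Rightarrow> real"
  assumes g: "integrable lborel g" and k: "integrable lborel k"
  shows "(\<integral>y. \<bar>marg g y - marg k y\<bar> \<partial>lborel) \<le> (\<integral>z. \<bar>g z - k z\<bar> \<partial>lborel)"
proof -
  have i: "integrable (lborel \<Otimes>\<^sub>M lborel) (case_prod (\<lambda>x y. f (x, y)))" if "integrable lborel f"
    for f :: "'a \<times> 'a \<Rightarrow> real" unfolding lborel_prod using that by simp
  note ai = integrable_abs[OF Bochner_Integration.integrable_diff[OF g k]]
  have "(\<integral>y. \<bar>marg g y - marg k y\<bar> \<partial>lborel) \<le> (\<integral>y. marg (\<lambda>z. \<bar>g z - k z\<bar>) y \<partial>lborel)"
  proof (rule integral_mono_AE)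
    show "integrable lborel (\<lambda>y. \<bar>marg g y - marg k y\<bar>)"
      using marg_test(1)[of "\<lambda>_. 1" g] marg_test(1)[of "\<lambda>_. 1" k] g k by (simp add: Bochner_Integration.integrable_diff)
    show "integrable lborel (marg (\<lambda>z. \<bar>g z - k z\<bar>))"
      using marg_test(1)[of "\<lambda>_. 1" "\<lambda>z. \<bar>g z - k z\<bar>"] ai by simp
    show "AE y in lborel. \<bar>marg g y - marg k y\<bar> \<le> marg (\<lambda>z. \<bar>g z - k z\<bar>) y"
      using lborel_pair.AE_integrable_snd[OF i[OF g]] lborel_pair.AE_integrable_snd[OF i[OF k]]
    proof eventually_elim
      case (elim y)
      have "\<bar>marg g y - marg k y\<bar> = \<bar>\<integral>x. g (x, y) - k (x, y) \<partial>lborel\<bar>"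
        using elim by (simp add: marg_def)
      also have "\<dots> \<le> marg (\<lambda>z. \<bar>g z - k z\<bar>) y" unfolding marg_def by (rule integral_abs_bound)
      finally show ?case .
    qed
  qed
  also have "\<dots> = (\<integral>z. \<bar>g z - k z\<bar> \<partial>lborel)"
    using marg_test(2)[of "\<lambda>_. 1" "\<lambda>z. \<bar>g z - k z\<bar>"] ai by simp
  finally show ?thesis .
qed

subsection \<open>The minimisation problem over plans\<close>

lemma integrable_tensor:
  fixes a :: "'a::euclidean_space \<Rightarrow> real" and b :: "'b::euclidean_space \<Rightarrow> real"
  assumes a: "integrable lborel a" and b: "integrable lborel b"
  shows "integrable lborel (\<lambda>z. a (fst z) * b (snd z))"
    "(\<integral>z. a (fst z) * b (snd z) \<partial>lborel) = (\<integral>x. a x \<partial>lborel) * (\<integral>y. b y \<partial>lborel)"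
proof -
  have [measurable]: "a \<in> borel_measurable borel" "b \<in> borel_measurable borel"
    using borel_measurable_integrable[OF a] borel_measurable_integrable[OF b] by simp_all
  have i: "integrable (lborel \<Otimes>\<^sub>M lborel) (\<lambda>z. a (fst z) * b (snd z))"
  proof (rule lborel_pair.Fubini_integrable)
    show "(\<lambda>z. a (fst z) * b (snd z)) \<in> borel_measurable (lborel \<Otimes>\<^sub>M lborel)" by measurable
    show "AE x in lborel. integrable lborel (\<lambda>y. a (fst (x, y)) * b (snd (x, y)))"
      by (simp add: b)
    have "(\<integral>y. norm (a (fst (x, y)) * b (snd (x, y))) \<partial>lborel) = \<bar>a x\<bar> * (\<integral>y. \<bar>b y\<bar> \<partial>lborel)" for x
      by (simp add: abs_mult)
    then show "integrable lborel (\<lambda>x. \<integral>y. norm (a (fst (x, y)) * b (snd (x, y))) \<partial>lborel)"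
      using a by simp
  qed
  then show "integrable lborel (\<lambda>z. a (fst z) * b (snd z))" by (simp add: lborel_prod)
  show "(\<integral>z. a (fst z) * b (snd z) \<partial>lborel) = (\<integral>x. a x \<partial>lborel) * (\<integral>y. b y \<partial>lborel)"
    using lborel_pair.integral_fst'[OF i] by (simp add: lborel_prod)
qed

lemma borel_fst_snd: "fst \<in> borel_measurable borel" "snd \<in> borel_measurable borel"
  by (intro borel_measurable_continuous_onI continuous_intros)+

text \<open>\<kappa> stands for 1 / (2 h). In \<open>c_coercive\<close> the first coordinate is
  charged separately because its moment is fixed by \<mu>. The last two assumptions give the product
  of \<mu> with itself a finite value.\<close>

locale entropic_step =
  fixes c :: "'a::euclidean_space \<times> 'a \<Rightarrow> real" and f :: "'a \<Rightarrow> real" and u :: "real \<Rightarrow> real"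
    and \<mu> :: "'a measure" and \<kappa> \<epsilon> Kc Kf C1 C2 :: real
  assumes c_cont: "continuous_on UNIV c" and c_nonneg: "\<And>z. 0 \<le> c z" and c_le: "\<And>z. c z \<le> Kc * mweight z"
    and c_coercive: "\<And>z. (norm z)\<^sup>2 \<le> C1 * (norm (fst z))\<^sup>2 + C2 * c z" and C2: "0 < C2"
    and f_cont: "continuous_on UNIV f" and f_nonneg: "\<And>y. 0 \<le> f y" and f_le: "\<And>y. f y \<le> Kf * mweight y"
    and u: "energy_integrand DIM('a) u"
    and \<mu>: "\<mu> \<in> P2r" and \<kappa>: "0 < \<kappa>" and \<epsilon>: "0 < \<epsilon>"
    and \<mu>_entropy: "integrable lborel (\<lambda>x. dens \<mu> x * ln (dens \<mu> x))"
    and \<mu>_energy: "integrable lborel (\<lambda>x. u (dens \<mu> x))"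
begin

text \<open>Finite entropy and internal energy are built in, so \<open>J\<close> is a genuine real
  number and its terms can be averaged. The couplings left out contribute an infinite value.\<close>

definition plan :: "('a \<times> 'a \<Rightarrow> real) \<Rightarrow> bool" where
  "plan g \<longleftrightarrow> prob_density g \<and> distr (dmeasure g) borel fst = \<mu> \<and>
     integrable lborel (\<lambda>z. g z * ln (g z)) \<and> integrable lborel (\<lambda>y. u (marg g y))"

definition J :: "('a \<times> 'a \<Rightarrow> real) \<Rightarrow> real" where
  "J g = \<kappa> * ((\<integral>z. c z * g z \<partial>lborel) + \<epsilon> * (\<integral>z. g z * ln (g z) \<partial>lborel)) +
     ((\<integral>y. f y * marg g y \<partial>lborel) + (\<integral>y. u (marg g y) \<partial>lborel))"

lemma c_meas: "c \<in> borel_measurable borel" and f_meas: "f \<in> borel_measurable borel"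
  using c_cont f_cont by (auto intro: borel_measurable_continuous_onI)

lemma planD:
  assumes "plan g"
  shows "prob_density g" "distr (dmeasure g) borel fst = \<mu>" "integrable lborel (\<lambda>z. g z * ln (g z))"
    "integrable lborel (\<lambda>y. u (marg g y))"
  using assms by (auto simp: plan_def)

lemma c_integrable: "moment_fun g \<Longrightarrow> integrable lborel (\<lambda>z. c z * g z)"
  by (rule integrable_moment_bound[OF _ c_meas, of _ Kc]) (simp_all add: c_nonneg c_le)

lemma f_integrable: "moment_fun r \<Longrightarrow> integrable lborel (\<lambda>y. f y * r y)"
  by (rule integrable_moment_bound[OF _ f_meas, of _ Kf]) (simp_all add: f_nonneg f_le)

lemma moment_marg: "prob_density g \<Longrightarrow> moment_fun (marg g)"
  using prob_density_marg prob_densityD(1) by blast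

text \<open>This competitor keeps the infimum from being taken over the empty set. The logarithm
  splits over the product, so its entropy reduces to that of \<mu>, and its second marginal is \<mu>
  again.\<close>

lemma plan_product: "plan (\<lambda>z. dens \<mu> (fst z) * dens \<mu> (snd z))"
proof -
  let ?m = "dens \<mu>" and ?g = "\<lambda>z. dens \<mu> (fst z) * dens \<mu> (snd z)"
  have p: "prob_density ?m" by (rule P2r_dens(2)[OF \<mu>])
  note m = prob_densityD[OF p]
  have [measurable]: "?m \<in> borel_measurable borel" by (rule m)
  note tm = integrable_tensor[OF m(6) m(6)]
  have n2: "integrable lborel (\<lambda>y. (norm y)\<^sup>2 * ?m y)"
    using Bochner_Integration.integrable_diff[OF m(5) m(6)] by (simp add: distrib_right)
  have "integrable lborel (\<lambda>z. (mweight (fst z) * ?m (fst z)) * ?m (snd z) + ?m (fst z) * ((norm (snd z))\<^sup>2 * ?m (snd z)))"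
    by (intro Bochner_Integration.integrable_add integrable_tensor(1)[OF m(5) m(6)] integrable_tensor(1)[OF m(6) n2])
  also have "(\<lambda>z. (mweight (fst z) * ?m (fst z)) * ?m (snd z) + ?m (fst z) * ((norm (snd z))\<^sup>2 * ?m (snd z)))
    = (\<lambda>z. mweight z * ?g z)"
    by (rule ext) (auto simp: norm_Pair_sq algebra_simps)
  finally have w: "integrable lborel (\<lambda>z. mweight z * ?g z)" .
  have gm: "?g \<in> borel_measurable borel"
    by (intro borel_measurable_times measurable_compose[OF borel_fst_snd(1) m(3)] measurable_compose[OF borel_fst_snd(2) m(3)])
  have pg: "prob_density ?g"
    using w gm tm m(2,4) by (simp add: prob_density_def moment_fun_def)
  have "integrable lborel (\<lambda>z. (?m (fst z) * ln (?m (fst z))) * ?m (snd z) + ?m (fst z) * (?m (snd z) * ln (?m (snd z))))"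
    by (intro Bochner_Integration.integrable_add integrable_tensor(1)[OF \<mu>_entropy m(6)] integrable_tensor(1)[OF m(6) \<mu>_entropy])
  also have "(\<lambda>z. (?m (fst z) * ln (?m (fst z))) * ?m (snd z) + ?m (fst z) * (?m (snd z) * ln (?m (snd z))))
     = (\<lambda>z. ?g z * ln (?g z))"
  proof
    fix z :: "'a \<times> 'a"
    \<comment> \<open>The product rule for \<open>ln\<close> is applied where both factors are
      positive; elsewhere both sides vanish.\<close>
    show "(?m (fst z) * ln (?m (fst z))) * ?m (snd z) + ?m (fst z) * (?m (snd z) * ln (?m (snd z))) = ?g z * ln (?g z)"
      using m(4)[of "fst z"] m(4)[of "snd z"]
      by (cases "?m (fst z) = 0 \<or> ?m (snd z) = 0") (auto simp: ln_mult algebra_simps)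
  qed
  finally have h: "integrable lborel (\<lambda>z. ?g z * ln (?g z))" .
  have mg: "marg ?g = ?m" using m(2) by (simp add: marg_def fun_eq_iff)
  have "distr (dmeasure ?g) borel fst = \<mu>"
  proof (rule measure_eqI)
    show s: "sets (distr (dmeasure ?g) borel fst) = sets \<mu>" using \<mu> by (simp add: P2r_def P2_def)
    fix A assume "A \<in> sets (distr (dmeasure ?g) borel fst)"
    then have A: "A \<in> sets borel" by simp
    have "distr \<mu> borel (\<lambda>x. x) = \<mu>" by (rule distr_id2) (use s in simp)
    then have d: "emeasure \<mu> A = ennreal (\<integral>x. indicator A x * ?m x \<partial>lborel)"
      and di: "integrable lborel (\<lambda>x. indicator A x * ?m x)"
      using measure_distr_dmeasure[OF p _ A, of "\<lambda>x. x"] by (simp_all add: P2r_dens(1)[OF \<mu>])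
    have "(\<integral>z. indicator A (fst z) * ?g z \<partial>lborel) = (\<integral>x. indicator A x * ?m x \<partial>lborel)"
      using integrable_tensor(2)[OF di m(6)] m(2) by (simp add: mult.assoc)
    then show "emeasure (distr (dmeasure ?g) borel fst) A = emeasure \<mu> A"
      unfolding d measure_distr_dmeasure(1)[OF pg borel_fst_snd(1) A] by simp
  qed
  then show ?thesis unfolding plan_def mg using pg h \<mu>_energy by simp
qed

text \<open>The first marginal is prescribed, so this part of the second moment is one constant
  shared by all plans.\<close>

lemma integral_fst_plan:
  assumes g: "plan g"
  shows "integrable lborel (\<lambda>z. (norm (fst z))\<^sup>2 * g z)"
    "(\<integral>z. (norm (fst z))\<^sup>2 * g z \<partial>lborel) = (\<integral>x. (norm x)\<^sup>2 \<partial>\<mu>)"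
proof -
  note m = prob_densityD[OF planD(1)[OF g]]
  have [measurable]: "(\<lambda>z::'a \<times> 'a. (norm (fst z))\<^sup>2) \<in> borel_measurable borel"
    by (intro borel_measurable_continuous_onI continuous_intros)
  show "integrable lborel (\<lambda>z. (norm (fst z))\<^sup>2 * g z)"
  proof (rule integrable_moment_bound[OF m(1), of _ 1])
    show "\<bar>(norm (fst z))\<^sup>2\<bar> \<le> 1 * mweight z" for z :: "'a \<times> 'a"
      using mweight_fst_le[of z] unfolding abs_power2 mult_1 by linarith
  qed simp
  have "(\<integral>x. (norm x)\<^sup>2 \<partial>\<mu>) = (\<integral>z. (norm (fst z))\<^sup>2 \<partial>dmeasure g)"
    unfolding planD(2)[OF g, symmetric]
    by (rule integral_distr) (simp_all add: borel_fst_snd)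
  also have "\<dots> = (\<integral>z. (norm (fst z))\<^sup>2 * g z \<partial>lborel)"
    using m(3,4) by (subst integral_density) (simp_all add: mult.commute)
  finally show "(\<integral>z. (norm (fst z))\<^sup>2 * g z \<partial>lborel) = (\<integral>x. (norm x)\<^sup>2 \<partial>\<mu>)" ..
qed

text \<open>Coercivity of \<open>J\<close> in the second moment W of the plan: the cost yields
  \<kappa> / C2 times W up to a constant, and the lower bounds for entropy and internal energy give
  back only part of it.\<close>

lemma J_parts_lower:
  obtains \<theta> Q where "0 < \<theta>"
    "\<And>g. plan g \<Longrightarrow> 0 \<le> (\<integral>z. c z * g z \<partial>lborel)"
    "\<And>g. plan g \<Longrightarrow> 0 \<le> (\<integral>y. f y * marg g y \<partial>lborel)"
    "\<And>g. plan g \<Longrightarrow> \<theta> * (\<integral>z. mweight z * g z \<partial>lborel) - Q \<le> J g"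
proof -
  define M0 where "M0 = (\<integral>x. (norm x)\<^sup>2 \<partial>\<mu>)"
  \<comment> \<open>The entropy loses \<kappa> \<epsilon> \<delta> W and the internal energy at most
    \<delta> W, up to constants. With this \<delta> the total loss is exactly half of the gain
    \<kappa> / C2 times W.\<close>
  define \<delta> where "\<delta> = \<kappa> / (2 * C2 * (\<kappa> * \<epsilon> + 1))"
  have ke: "0 < \<kappa> * \<epsilon> + 1" using \<kappa> \<epsilon> by (simp add: add_pos_pos)
  have \<delta>: "0 < \<delta>" unfolding \<delta>_def using \<kappa> C2 ke by simp
  have \<delta>': "\<kappa> * \<epsilon> * \<delta> + \<delta> = \<kappa> / (2 * C2)"
  proof -
    have "\<kappa> * \<epsilon> * \<delta> + \<delta> = (\<kappa> * \<epsilon> + 1) * \<delta>" by (simp add: distrib_right)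
    also have "\<dots> = \<kappa> / (2 * C2)" unfolding \<delta>_def using ke by simp
    finally show ?thesis .
  qed
  obtain Q1 where Q1: "\<And>r :: 'a \<times> 'a \<Rightarrow> real. moment_fun r \<Longrightarrow> integrable lborel (\<lambda>x. r x * ln (r x)) \<Longrightarrow>
     - \<delta> * (\<integral>x. mweight x * r x \<partial>lborel) - Q1 \<le> (\<integral>x. r x * ln (r x) \<partial>lborel)"
    using energy_integral_lower[OF energy_integrand_entropy \<delta>, where 'a = "'a \<times> 'a"] by blast
  obtain Q2 where Q2: "\<And>r :: 'a \<Rightarrow> real. moment_fun r \<Longrightarrow> integrable lborel (\<lambda>x. u (r x)) \<Longrightarrow>
     - \<delta> * (\<integral>x. mweight x * r x \<partial>lborel) - Q2 \<le> (\<integral>x. u (r x) \<partial>lborel)"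
    using energy_integral_lower[OF u \<delta>] by blast
  have c0: "0 \<le> (\<integral>z. c z * g z \<partial>lborel)" if "plan g" for g
    using prob_densityD(4)[OF planD(1)[OF that]] c_nonneg by (intro integral_nonneg_AE) simp
  have f0: "0 \<le> (\<integral>y. f y * marg g y \<partial>lborel)" if "plan g" for g
    using moment_funD(2)[OF moment_marg[OF planD(1)[OF that]]] f_nonneg by (intro integral_nonneg_AE) simp
  show ?thesis
  proof (rule that[of "\<kappa> / (2 * C2)" "\<kappa> / C2 * (1 + C1 * M0) + \<kappa> * \<epsilon> * Q1 + Q2"])
    show "0 < \<kappa> / (2 * C2)" using \<kappa> C2 by simp
    fix g assume g: "plan g"
    note m = prob_densityD[OF planD(1)[OF g]]
    note n = integral_fst_plan[OF g] and ci = c_integrable[OF m(1)]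
    define W where "W = (\<integral>z. mweight z * g z \<partial>lborel)"
    define X where "X = (\<integral>z. c z * g z \<partial>lborel)"
    have "W \<le> (\<integral>z. g z + C1 * ((norm (fst z))\<^sup>2 * g z) + C2 * (c z * g z) \<partial>lborel)"
      unfolding W_def
    proof (rule integral_mono)
      fix z :: "'a \<times> 'a"
      have "mweight z * g z \<le> (1 + (C1 * (norm (fst z))\<^sup>2 + C2 * c z)) * g z"
        by (intro mult_right_mono add_left_mono c_coercive m)
      then show "mweight z * g z \<le> g z + C1 * ((norm (fst z))\<^sup>2 * g z) + C2 * (c z * g z)"
        by (simp add: algebra_simps)
    next
      show "integrable lborel (\<lambda>z. g z + C1 * ((norm (fst z))\<^sup>2 * g z) + C2 * (c z * g z))"
        by (intro Bochner_Integration.integrable_add integrable_mult_right n(1) ci m)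
    qed (rule m)
    also have "\<dots> = 1 + C1 * M0 + C2 * X"
      unfolding X_def M0_def n(2)[symmetric] using m(2,6) n(1) ci by simp
    finally have "W - (1 + C1 * M0) \<le> C2 * X" by simp
    then have "(W - (1 + C1 * M0)) / C2 \<le> X" using C2 by (simp add: divide_le_eq mult.commute)
    then have X: "\<kappa> / C2 * W - \<kappa> / C2 * (1 + C1 * M0) \<le> \<kappa> * X"
      using mult_left_mono[of "(W - (1 + C1 * M0)) / C2" X \<kappa>] \<kappa> by (simp add: diff_divide_distrib right_diff_distrib)
    have e: "- \<delta> * W - Q1 \<le> (\<integral>z. g z * ln (g z) \<partial>lborel)"
      unfolding W_def by (rule Q1[OF m(1) planD(3)[OF g]])
    then have e': "\<kappa> * \<epsilon> * (- \<delta> * W - Q1) \<le> \<kappa> * \<epsilon> * (\<integral>z. g z * ln (g z) \<partial>lborel)"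
      using \<kappa> \<epsilon> by (intro mult_left_mono) simp_all
    have "- \<delta> * W - Q2 \<le> - \<delta> * (\<integral>y. mweight y * marg g y \<partial>lborel) - Q2"
      unfolding W_def using marg_moment_le[OF planD(1)[OF g]] \<delta> by simp
    also have "\<dots> \<le> (\<integral>y. u (marg g y) \<partial>lborel)"
      by (rule Q2[OF moment_marg[OF planD(1)[OF g]] planD(4)[OF g]])
    finally have U: "- \<delta> * W - Q2 \<le> (\<integral>y. u (marg g y) \<partial>lborel)" .
    have "\<kappa> / (2 * C2) * W = \<kappa> / C2 * W - (\<kappa> * \<epsilon> * \<delta> + \<delta>) * W"
      unfolding \<delta>' using C2 by (simp add: field_simps)
    then have "\<kappa> / (2 * C2) * W - (\<kappa> / C2 * (1 + C1 * M0) + \<kappa> * \<epsilon> * Q1 + Q2)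
      = (\<kappa> / C2 * W - \<kappa> / C2 * (1 + C1 * M0)) + \<kappa> * \<epsilon> * (- \<delta> * W - Q1) + 0 + (- \<delta> * W - Q2)"
      by (simp add: algebra_simps)
    also have "\<dots> \<le> \<kappa> * X + \<kappa> * \<epsilon> * (\<integral>z. g z * ln (g z) \<partial>lborel)
      + (\<integral>y. f y * marg g y \<partial>lborel) + (\<integral>y. u (marg g y) \<partial>lborel)"
      by (intro add_mono X e' f0[OF g] U)
    also have "\<dots> = J g" by (simp add: J_def X_def distrib_left mult.assoc)
    finally show "\<kappa> / (2 * C2) * (\<integral>z. mweight z * g z \<partial>lborel) - (\<kappa> / C2 * (1 + C1 * M0) + \<kappa> * \<epsilon> * Q1 + Q2) \<le> J g"
      unfolding W_def .
  qed (use c0 f0 in blast)+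
qed

text \<open>Cost and potential average exactly and \<open>u\<close> is convex, while the entropy gap
  is retained instead of being discarded. The retained gap is the quantitative strict
  convexity.\<close>

lemma plan_mid:
  assumes g: "plan g" and k: "plan k"
  defines "r \<equiv> \<lambda>z. (g z + k z) / 2"
  shows "plan r"
    "2 * J r + \<kappa> * \<epsilon> * ((\<integral>z. g z * ln (g z) \<partial>lborel) + (\<integral>z. k z * ln (k z) \<partial>lborel) - 2 * (\<integral>z. r z * ln (r z) \<partial>lborel))
      \<le> J g + J k"
proof -
  note gm = prob_densityD[OF planD(1)[OF g]] and km = prob_densityD[OF planD(1)[OF k]]
  have mr: "moment_fun r" unfolding r_def by (rule moment_fun_mid[OF gm(1) km(1)])
  have pr: "prob_density r" unfolding prob_density_def using mr gm km by (simp add: r_def)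
  note rm = prob_densityD[OF pr]
  have h: "integrable lborel (\<lambda>z. r z * ln (r z))"
    unfolding r_def by (rule energy_mid_integrable(1)[OF energy_integrand_entropy gm(1) planD(3)[OF g] km(1) planD(3)[OF k]])
  have fst: "distr (dmeasure r) borel fst = \<mu>"
  proof (rule measure_eqI)
    show s: "sets (distr (dmeasure r) borel fst) = sets \<mu>" using \<mu> by (simp add: P2r_def P2_def)
    fix A assume "A \<in> sets (distr (dmeasure r) borel fst)"
    then have A: "A \<in> sets borel" by simp
    note d = measure_distr_dmeasure[OF _ borel_fst_snd(1) A]
    let ?I = "\<lambda>g. \<integral>z. indicator A (fst z) * g z \<partial>lborel"
    have nn: "0 \<le> ?I g" if "\<And>z. 0 \<le> g z" for g :: "'a \<times> 'a \<Rightarrow> real" using that by (intro integral_nonneg_AE) simp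
    have eg: "emeasure \<mu> A = ennreal (?I g)" using d(1)[OF planD(1)[OF g]] planD(2)[OF g] by simp
    have ek: "emeasure \<mu> A = ennreal (?I k)" using d(1)[OF planD(1)[OF k]] planD(2)[OF k] by simp
    have "?I g = ?I k" using eg ek nn[OF gm(4)] nn[OF km(4)] by simp
    moreover have "?I r = (?I g + ?I k) / 2"
      unfolding r_def using d(2)[OF planD(1)[OF g]] d(2)[OF planD(1)[OF k]] by (simp add: distrib_left)
    ultimately show "emeasure (distr (dmeasure r) borel fst) A = emeasure \<mu> A"
      unfolding d(1)[OF pr] using eg by simp
  qed
  have i: "integrable (lborel \<Otimes>\<^sub>M lborel) (case_prod (\<lambda>x y. f (x, y)))" if "integrable lborel f"
    for f :: "'a \<times> 'a \<Rightarrow> real" unfolding lborel_prod using that by simp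
  \<comment> \<open>On a null set the sections may fail to be integrable and \<open>marg\<close>
    need not be additive; hence the almost-everywhere transfers that follow.\<close>
  have mg: "AE y in lborel. marg r y = (marg g y + marg k y) / 2"
    using lborel_pair.AE_integrable_snd[OF i[OF gm(6)]] lborel_pair.AE_integrable_snd[OF i[OF km(6)]]
    by eventually_elim (simp add: marg_def r_def)
  note mo = moment_marg[OF planD(1)[OF g]] moment_marg[OF planD(1)[OF k]] moment_marg[OF pr]
  note mid = energy_mid_integrable[OF u mo(1) planD(4)[OF g] mo(2) planD(4)[OF k]]
  have um: "(\<lambda>y. u (marg r y)) \<in> borel_measurable lborel"
    by (rule energy_integrand_measurable[OF u]) (use moment_funD(1,2)[OF mo(3)] in simp_all)
  have uae: "AE y in lborel. u (marg r y) = u ((marg g y + marg k y) / 2)"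
    using mg by eventually_elim (simp only:)
  have ui: "integrable lborel (\<lambda>y. u (marg r y))"
    using integrable_cong_AE[OF um borel_measurable_integrable[OF mid(1)] uae] mid(1) by simp
  show "plan r" unfolding plan_def using pr fst h ui by simp
  have U: "2 * (\<integral>y. u (marg r y) \<partial>lborel) \<le> (\<integral>y. u (marg g y) \<partial>lborel) + (\<integral>y. u (marg k y) \<partial>lborel)"
    using mid(2) integral_cong_AE[OF um borel_measurable_integrable[OF mid(1)] uae] by simp
  have F: "2 * (\<integral>y. f y * marg r y \<partial>lborel) = (\<integral>y. f y * marg g y \<partial>lborel) + (\<integral>y. f y * marg k y \<partial>lborel)"
  proof -
    have "(\<integral>y. f y * marg r y \<partial>lborel) = (\<integral>y. (f y * marg g y + f y * marg k y) / 2 \<partial>lborel)"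
    proof (rule integral_cong_AE)
      show "AE y in lborel. f y * marg r y = (f y * marg g y + f y * marg k y) / 2"
        using mg by eventually_elim (simp only: distrib_left times_divide_eq_right)
    qed (use f_meas moment_funD(1)[OF mo(1)] moment_funD(1)[OF mo(2)] moment_funD(1)[OF mo(3)] in simp_all)
    then show ?thesis using f_integrable[OF mo(1)] f_integrable[OF mo(2)] by simp
  qed
  have Cc: "2 * (\<integral>z. c z * r z \<partial>lborel) = (\<integral>z. c z * g z \<partial>lborel) + (\<integral>z. c z * k z \<partial>lborel)"
    unfolding r_def using c_integrable[OF gm(1)] c_integrable[OF km(1)] by (simp add: distrib_left)
  have "2 * J r + \<kappa> * \<epsilon> * ((\<integral>z. g z * ln (g z) \<partial>lborel) + (\<integral>z. k z * ln (k z) \<partial>lborel) - 2 * (\<integral>z. r z * ln (r z) \<partial>lborel))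
    = \<kappa> * (2 * (\<integral>z. c z * r z \<partial>lborel)) + \<kappa> * \<epsilon> * ((\<integral>z. g z * ln (g z) \<partial>lborel) + (\<integral>z. k z * ln (k z) \<partial>lborel))
      + (2 * (\<integral>y. f y * marg r y \<partial>lborel) + 2 * (\<integral>y. u (marg r y) \<partial>lborel))"
    by (simp add: J_def algebra_simps)
  also have "\<dots> \<le> \<kappa> * ((\<integral>z. c z * g z \<partial>lborel) + (\<integral>z. c z * k z \<partial>lborel)) + \<kappa> * \<epsilon> * ((\<integral>z. g z * ln (g z) \<partial>lborel) + (\<integral>z. k z * ln (k z) \<partial>lborel))
      + ((\<integral>y. f y * marg g y \<partial>lborel) + (\<integral>y. f y * marg k y \<partial>lborel) + ((\<integral>y. u (marg g y) \<partial>lborel) + (\<integral>y. u (marg k y) \<partial>lborel)))"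
    unfolding Cc F using U by simp
  also have "\<dots> = J g + J k" by (simp add: J_def algebra_simps)
  finally show "2 * J r + \<kappa> * \<epsilon> * ((\<integral>z. g z * ln (g z) \<partial>lborel) + (\<integral>z. k z * ln (k z) \<partial>lborel) - 2 * (\<integral>z. r z * ln (r z) \<partial>lborel))
      \<le> J g + J k" .
qed

section \<open>Almost minimisers and existence of a minimising plan\<close>

text \<open>Two almost minimisers are \<open>L\<^sup>1\<close>-close: the midpoint cannot beat the infimum, so the entropy gap
  between them is small. This replaces weak compactness in the existence proof and also yields uniqueness.\<close>

lemma almost_minimisers_close:
  assumes g: "plan g" "J g \<le> I + \<delta>" and k: "plan k" "J k \<le> I + \<delta>" and "0 < \<delta>"
    and I: "\<And>g. plan g \<Longrightarrow> I \<le> J g"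
  shows "(\<integral>z. \<bar>g z - k z\<bar> \<partial>lborel) \<le> (2 / (\<kappa> * \<epsilon>) + 6) * sqrt \<delta>"
proof -
  let ?h = "\<lambda>g. \<integral>z. g z * ln (g z) \<partial>lborel"
  let ?r = "\<lambda>z. (g z + k z) / 2"
  define G where "G = ?h g + ?h k - 2 * ?h ?r"
  \<comment> \<open>Makes both terms of \<open>abs_diff_le_entropy_gap\<close> proportional to the
    square root of \<delta>; the constant 6 is 3 times the total mass 2.\<close>
  define t where "t = sqrt \<delta>"
  have t: "0 < t" "t * t = \<delta>" using \<open>0 < \<delta>\<close> by (auto simp: t_def)
  note mid = plan_mid[OF g(1) k(1)]
  note gm = prob_densityD[OF planD(1)[OF g(1)]] and km = prob_densityD[OF planD(1)[OF k(1)]]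
  have "2 * I + \<kappa> * \<epsilon> * G \<le> 2 * J ?r + \<kappa> * \<epsilon> * G" using I[OF mid(1)] by simp
  also have "\<dots> \<le> J g + J k" using mid(2) by (simp only: G_def)
  also have "\<dots> \<le> 2 * I + 2 * \<delta>" using g(2) k(2) by simp
  finally have "\<kappa> * \<epsilon> * G \<le> 2 * \<delta>" by simp
  then have G: "G \<le> 2 / (\<kappa> * \<epsilon>) * \<delta>" using \<kappa> \<epsilon> by (simp add: field_simps)
  note i = planD(3)[OF g(1)] planD(3)[OF k(1)] planD(3)[OF mid(1)]
  have "(\<integral>z. \<bar>g z - k z\<bar> \<partial>lborel) \<le>
    (\<integral>z. (g z * ln (g z) + k z * ln (k z) - 2 * (?r z * ln (?r z))) / t + 3 * t * (g z + k z) \<partial>lborel)"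
  proof (rule integral_mono)
    show "integrable lborel (\<lambda>z. (g z * ln (g z) + k z * ln (k z) - 2 * (?r z * ln (?r z))) / t + 3 * t * (g z + k z))"
      by (intro Bochner_Integration.integrable_add Bochner_Integration.integrable_diff integrable_mult_right integrable_divide_zero i gm km)
    show "integrable lborel (\<lambda>z. \<bar>g z - k z\<bar>)" by (intro integrable_abs Bochner_Integration.integrable_diff gm km)
    show "\<bar>g z - k z\<bar> \<le> (g z * ln (g z) + k z * ln (k z) - 2 * (?r z * ln (?r z))) / t + 3 * t * (g z + k z)" for z
      by (rule abs_diff_le_entropy_gap[OF gm(4) km(4) t(1)])
  qed
  also have "\<dots> = G / t + 3 * t * 2"
  proof -
    have a1: "(\<integral>z. (g z * ln (g z) + k z * ln (k z) - 2 * (?r z * ln (?r z))) / t + 3 * t * (g z + k z) \<partial>lborel)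
      = (\<integral>z. (g z * ln (g z) + k z * ln (k z) - 2 * (?r z * ln (?r z))) / t \<partial>lborel) + (\<integral>z. 3 * t * (g z + k z) \<partial>lborel)"
      by (intro Bochner_Integration.integral_add Bochner_Integration.integrable_add Bochner_Integration.integrable_diff integrable_mult_right integrable_divide_zero i gm km)
    have a2: "(\<integral>z. (g z * ln (g z) + k z * ln (k z) - 2 * (?r z * ln (?r z))) / t \<partial>lborel) = G / t"
      unfolding G_def integral_divide_zero Bochner_Integration.integral_diff[OF Bochner_Integration.integrable_add[OF i(1,2)] integrable_mult_right[OF i(3)]]
        Bochner_Integration.integral_add[OF i(1,2)] integral_mult_right_zero ..
    have a3: "(\<integral>z. 3 * t * (g z + k z) \<partial>lborel) = 3 * t * 2"
      unfolding integral_mult_right_zero Bochner_Integration.integral_add[OF gm(6) km(6)] gm(2) km(2) by simp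
    show ?thesis unfolding a1 a2 a3 ..
  qed
  also have "\<dots> \<le> 2 / (\<kappa> * \<epsilon>) * t + 6 * t"
  proof -
    have "G / t \<le> 2 / (\<kappa> * \<epsilon>) * (t * t) / t"
      using divide_right_mono[OF G less_imp_le[OF t(1)]] unfolding t(2) .
    also have "\<dots> = 2 / (\<kappa> * \<epsilon>) * t" using t(1) by simp
    finally show ?thesis by simp
  qed
  finally show ?thesis unfolding t_def distrib_right .
qed

text \<open>A real infimum has a meaning only for a nonempty set bounded below;
  \<open>plan_product\<close> and \<open>J_parts_lower\<close> provide both.\<close>

definition J_inf :: real where "J_inf = Inf (J ` Collect plan)"

lemma J_inf_le: "plan g \<Longrightarrow> J_inf \<le> J g"
proof -
  assume g: "plan g"
  obtain \<theta> Q where t: "0 < \<theta>" and lo: "\<And>g. plan g \<Longrightarrow> \<theta> * (\<integral>z. mweight z * g z \<partial>lborel) - Q \<le> J g"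
    using J_parts_lower by metis
  have "- Q \<le> J g" if "plan g" for g
  proof -
    have "0 \<le> (\<integral>z. mweight z * g z \<partial>lborel)"
      using prob_densityD(4)[OF planD(1)[OF that]] by (intro integral_nonneg_AE) (simp add: add_nonneg_nonneg)
    then have "0 \<le> \<theta> * (\<integral>z. mweight z * g z \<partial>lborel)" using t by simp
    then show ?thesis using lo[OF that] by linarith
  qed
  then have "bdd_below (J ` Collect plan)" by (intro bdd_belowI[of _ "- Q"]) auto
  then show "J_inf \<le> J g" unfolding J_inf_def using g by (intro cInf_lower) auto
qed

lemma J_inf_approx: "0 < e \<Longrightarrow> \<exists>g. plan g \<and> J g < J_inf + e"
proof -
  assume e: "0 < e"
  have ne: "J ` Collect plan \<noteq> {}" using plan_product by auto
  from cInf_lessD[OF ne, of "J_inf + e"] e show ?thesis unfolding J_inf_def by auto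
qed

text \<open>A bound on the sum gives no convergence of the terms. But each term is bounded below, so
  all four are bounded and converge along a common subsequence; lower semicontinuity then applies to
  each, and the limits add up.\<close>

lemma J_lsc:
  assumes g: "\<And>n. plan (g n)" and J: "\<And>n. J (g n) \<le> J_inf + d n" and d: "d \<longlonglongrightarrow> 0" and d1: "\<And>n. d n \<le> 1"
    and W: "\<And>n. (\<integral>z. mweight z * g n z \<partial>lborel) \<le> B"
    and lim: "AE z in lborel. (\<lambda>n. g n z) \<longlonglongrightarrow> h z" and limm: "AE y in lborel. (\<lambda>n. marg (g n) y) \<longlonglongrightarrow> marg h y"
    and h: "prob_density h" "distr (dmeasure h) borel fst = \<mu>"
  shows "plan h \<and> J h \<le> J_inf"
proof -
  define a where "a n = (\<integral>z. c z * g n z \<partial>lborel)" for n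
  define b where "b n = (\<integral>z. g n z * ln (g n z) \<partial>lborel)" for n
  define p where "p n = (\<integral>y. f y * marg (g n) y \<partial>lborel)" for n
  define q where "q n = (\<integral>y. u (marg (g n) y) \<partial>lborel)" for n
  have Jn: "J (g n) = \<kappa> * (a n + \<epsilon> * b n) + (p n + q n)" for n
    by (simp add: J_def a_def b_def p_def q_def)
  note gm = prob_densityD[OF planD(1)[OF g]] and mm = moment_marg[OF planD(1)[OF g]]
  have WM: "(\<integral>y. mweight y * marg (g n) y \<partial>lborel) \<le> B" for n
    using marg_moment_le[OF planD(1)[OF g[of n]]] W[of n] by simp
  obtain Q1 where Q1: "\<And>r :: 'a \<times> 'a \<Rightarrow> real. moment_fun r \<Longrightarrow> integrable lborel (\<lambda>x. r x * ln (r x)) \<Longrightarrow>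
     - 1 * (\<integral>x. mweight x * r x \<partial>lborel) - Q1 \<le> (\<integral>x. r x * ln (r x) \<partial>lborel)"
    using energy_integral_lower[OF energy_integrand_entropy zero_less_one, where 'a = "'a \<times> 'a"] by blast
  obtain Q2 where Q2: "\<And>r :: 'a \<Rightarrow> real. moment_fun r \<Longrightarrow> integrable lborel (\<lambda>x. u (r x)) \<Longrightarrow>
     - 1 * (\<integral>x. mweight x * r x \<partial>lborel) - Q2 \<le> (\<integral>x. u (r x) \<partial>lborel)"
    using energy_integral_lower[OF u zero_less_one] by blast
  have a0: "0 \<le> a n" for n unfolding a_def using gm(4) c_nonneg by (intro integral_nonneg_AE) simp
  have p0: "0 \<le> p n" for n unfolding p_def using moment_funD(2)[OF mm] f_nonneg by (intro integral_nonneg_AE) simp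
  have b0: "- B - Q1 \<le> b n" for n
    using Q1[OF gm(1)[of n] planD(3)[OF g[of n]]] W[of n] by (simp add: b_def)
  have q0: "- B - Q2 \<le> q n" for n
    using Q2[OF mm[of n] planD(4)[OF g[of n]]] WM[of n] by (simp add: q_def)
  have up: "\<kappa> * a n + \<kappa> * \<epsilon> * b n + p n + q n \<le> J_inf + 1" for n
    using J[of n] d1[of n] by (simp add: Jn distrib_left mult.assoc)
  define L where "L = \<bar>J_inf + 1\<bar> + \<bar>\<kappa> * \<epsilon> * (B + Q1)\<bar> + \<bar>B + Q2\<bar>"
  have ke: "0 < \<kappa> * \<epsilon>" using \<kappa> \<epsilon> by simp
  have kb: "- (\<kappa> * \<epsilon> * (B + Q1)) \<le> \<kappa> * \<epsilon> * b n" for n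
    using mult_left_mono[OF b0[of n] less_imp_le[OF ke]] by (simp add: algebra_simps)
  have ka: "0 \<le> \<kappa> * a n" for n using a0 \<kappa> by simp
  \<comment> \<open>Packing the four values into one vector yields a single subsequence for all of
    them.\<close>
  define v where "v n = (\<kappa> * a n, \<kappa> * \<epsilon> * b n, p n, q n)" for n
  have "norm (v n) \<le> 4 * L" for n
  proof -
    have "\<bar>\<kappa> * a n\<bar> \<le> L" "\<bar>\<kappa> * \<epsilon> * b n\<bar> \<le> L" "\<bar>p n\<bar> \<le> L" "\<bar>q n\<bar> \<le> L"
      unfolding L_def using up[of n] ka[of n] kb[of n] p0[of n] q0[of n] by linarith+
    moreover have "norm (v n) \<le> norm (\<kappa> * a n) + (norm (\<kappa> * \<epsilon> * b n) + (norm (p n) + norm (q n)))"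
      unfolding v_def by (intro order_trans[OF norm_Pair_le] add_left_mono order.refl)
    ultimately show ?thesis unfolding real_norm_def by linarith
  qed
  then have "bounded (range v)" by (intro boundedI[of _ "4 * L"]) auto
  then obtain l s where s: "strict_mono s" and vl: "(v \<circ> s) \<longlonglongrightarrow> l"
    using bounded_imp_convergent_subsequence[of v] by blast
  obtain a' b' p' q' where l: "l = (a', b', p', q')" by (cases l) auto
  have ta: "(\<lambda>n. \<kappa> * a (s n)) \<longlonglongrightarrow> a'" using tendsto_fst[OF vl] by (simp add: v_def l comp_def)
  have tb: "(\<lambda>n. \<kappa> * \<epsilon> * b (s n)) \<longlonglongrightarrow> b'" using tendsto_fst[OF tendsto_snd[OF vl]] by (simp add: v_def l comp_def)
  have tp: "(\<lambda>n. p (s n)) \<longlonglongrightarrow> p'" using tendsto_fst[OF tendsto_snd[OF tendsto_snd[OF vl]]] by (simp add: v_def l comp_def)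
  have tq: "(\<lambda>n. q (s n)) \<longlonglongrightarrow> q'" using tendsto_snd[OF tendsto_snd[OF tendsto_snd[OF vl]]] by (simp add: v_def l comp_def)
  have ta': "(\<lambda>n. a (s n)) \<longlonglongrightarrow> a' / \<kappa>" using tendsto_divide[OF ta tendsto_const[of \<kappa>]] \<kappa> by simp
  have tb': "(\<lambda>n. b (s n)) \<longlonglongrightarrow> b' / (\<kappa> * \<epsilon>)" using tendsto_divide[OF tb tendsto_const[of "\<kappa> * \<epsilon>"]] \<kappa> \<epsilon> by simp
  have ls: "AE z in lborel. (\<lambda>n. g (s n) z) \<longlonglongrightarrow> h z"
    using lim by eventually_elim (drule LIMSEQ_subseq_LIMSEQ[OF _ s], simp add: comp_def)
  have lms: "AE y in lborel. (\<lambda>n. marg (g (s n)) y) \<longlonglongrightarrow> marg h y"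
    using limm by eventually_elim (drule LIMSEQ_subseq_LIMSEQ[OF _ s], simp add: comp_def)
  note hm = prob_densityD[OF h(1)] and hmm = moment_marg[OF h(1)]
  have Sc: "(\<integral>z. c z * h z \<partial>lborel) \<le> a' / \<kappa>"
  proof (rule integrable_Fatou_real[where Fn = "\<lambda>n z. c z * g (s n) z" and l = "\<lambda>n. a (s n)", THEN conjunct2])
    show "AE z in lborel. (\<lambda>n. c z * g (s n) z) \<longlonglongrightarrow> c z * h z"
      using ls by eventually_elim (intro tendsto_intros)
    show "(\<lambda>z. c z * h z) \<in> borel_measurable lborel" by (rule borel_measurable_integrable[OF c_integrable[OF hm(1)]])
    show "integrable lborel (\<lambda>z. c z * g (s n) z)" for n by (rule c_integrable[OF gm(1)])
  qed (use ta' gm(4) c_nonneg in \<open>simp_all add: a_def\<close>)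
  have Sp: "(\<integral>y. f y * marg h y \<partial>lborel) \<le> p'"
  proof (rule integrable_Fatou_real[where Fn = "\<lambda>n y. f y * marg (g (s n)) y" and l = "\<lambda>n. p (s n)", THEN conjunct2])
    show "AE y in lborel. (\<lambda>n. f y * marg (g (s n)) y) \<longlonglongrightarrow> f y * marg h y"
      using lms by eventually_elim (intro tendsto_intros)
    show "(\<lambda>y. f y * marg h y) \<in> borel_measurable lborel" by (rule borel_measurable_integrable[OF f_integrable[OF hmm]])
    show "integrable lborel (\<lambda>y. f y * marg (g (s n)) y)" for n by (rule f_integrable[OF mm])
  qed (use tp moment_funD(2)[OF mm] f_nonneg in \<open>simp_all add: p_def\<close>)
  have Sb: "integrable lborel (\<lambda>z. h z * ln (h z))" "(\<integral>z. h z * ln (h z) \<partial>lborel) \<le> b' / (\<kappa> * \<epsilon>)"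
    using energy_lsc[OF energy_integrand_entropy gm(1) W planD(3)[OF g] _ tb' hm(1) ls] unfolding b_def by simp_all
  have Sq: "integrable lborel (\<lambda>y. u (marg h y))" "(\<integral>y. u (marg h y) \<partial>lborel) \<le> q'"
    using energy_lsc[OF u mm WM planD(4)[OF g] _ tq hmm lms] unfolding q_def by simp_all
  have "J h \<le> J_inf"
  proof -
    have "J h = \<kappa> * (\<integral>z. c z * h z \<partial>lborel) + \<kappa> * \<epsilon> * (\<integral>z. h z * ln (h z) \<partial>lborel)
        + (\<integral>y. f y * marg h y \<partial>lborel) + (\<integral>y. u (marg h y) \<partial>lborel)"
      by (simp add: J_def distrib_left mult.assoc)
    also have "\<dots> \<le> \<kappa> * (a' / \<kappa>) + \<kappa> * \<epsilon> * (b' / (\<kappa> * \<epsilon>)) + p' + q'"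
      using \<kappa> ke by (intro add_mono mult_left_mono Sc Sp Sb Sq) simp_all
    also have "\<dots> = a' + b' + p' + q'" using \<kappa> \<epsilon> by simp
    also have "\<dots> \<le> J_inf + 0"
    proof (rule LIMSEQ_le)
      show "(\<lambda>n. \<kappa> * a (s n) + \<kappa> * \<epsilon> * b (s n) + p (s n) + q (s n)) \<longlonglongrightarrow> a' + b' + p' + q'"
        by (intro tendsto_add ta tb tp tq)
      show "(\<lambda>n. J_inf + d (s n)) \<longlonglongrightarrow> J_inf + 0"
        using LIMSEQ_subseq_LIMSEQ[OF d s] by (intro tendsto_add tendsto_const) (simp add: comp_def)
      show "\<exists>N. \<forall>n\<ge>N. \<kappa> * a (s n) + \<kappa> * \<epsilon> * b (s n) + p (s n) + q (s n) \<le> J_inf + d (s n)"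
        using J unfolding Jn by (simp add: distrib_left mult.assoc add.assoc)
    qed
    finally show ?thesis by simp
  qed
  then show ?thesis unfolding plan_def using h Sb Sq by simp
qed

lemma J_attained: "\<exists>g. plan g \<and> J g = J_inf"
proof -
  define K where "K = 2 / (\<kappa> * \<epsilon>) + 6"
  have K: "6 \<le> K" using \<kappa> \<epsilon> by (simp add: K_def)
  \<comment> \<open>Chosen so that \<open>almost_minimisers_close\<close> returns (1/2)^n, the rate
    that \<open>L1_fast_Cauchy_converges\<close> asks for.\<close>
  define d where "d n = ((1/2) ^ n / K)\<^sup>2" for n
  have d0: "0 < d n" for n using K by (simp add: d_def)
  have dmono: "d (Suc n) \<le> d n" for n
    unfolding d_def using K by (intro power_mono divide_right_mono) simp_all
  have sd: "K * sqrt (d n) = (1/2) ^ n" for n using K by (simp add: d_def)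
  have d1: "d n \<le> 1" for n
  proof -
    have "(1/2) ^ n \<le> (1::real)" by (rule power_le_one) auto
    then have "(1/2) ^ n / K \<le> 1" using K by (simp add: divide_le_eq)
    then show ?thesis unfolding d_def using K by (intro power_le_one) simp_all
  qed
  have dl: "d \<longlonglongrightarrow> 0"
  proof -
    have "(\<lambda>n. ((1/2) ^ n / K)\<^sup>2) \<longlonglongrightarrow> (0 / K)\<^sup>2"
      using K by (intro tendsto_intros LIMSEQ_power_zero) simp_all
    then show ?thesis by (simp add: d_def[abs_def])
  qed
  obtain g where g: "\<And>n. plan (g n)" and gJ: "\<And>n. J (g n) < J_inf + d n"
    using J_inf_approx[OF d0] by metis
  note gm = prob_densityD[OF planD(1)[OF g]] and mm = moment_marg[OF planD(1)[OF g]]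
  have close: "(\<integral>z. \<bar>g (Suc n) z - g n z\<bar> \<partial>lborel) \<le> (1/2) ^ n" for n
    using almost_minimisers_close[OF g[of "Suc n"] _ g[of n] less_imp_le[OF gJ] d0 J_inf_le] gJ[of "Suc n"] dmono[of n]
    unfolding K_def[symmetric] sd by simp
  have closem: "(\<integral>y. \<bar>marg (g (Suc n)) y - marg (g n) y\<bar> \<partial>lborel) \<le> (1/2) ^ n" for n
    using marg_L1[OF gm(6) gm(6), of "Suc n" n] close[of n] by simp
  obtain k where k: "integrable lborel k" and kae: "AE z in lborel. (\<lambda>n. g n z) \<longlonglongrightarrow> k z"
    and kL: "(\<lambda>n. \<integral>z. \<bar>k z - g n z\<bar> \<partial>lborel) \<longlonglongrightarrow> 0"
    using L1_fast_Cauchy_converges[OF gm(6) close] by blast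
  obtain \<rho> where \<rho>: "integrable lborel \<rho>" and rae: "AE y in lborel. (\<lambda>n. marg (g n) y) \<longlonglongrightarrow> \<rho> y"
    and rL: "(\<lambda>n. \<integral>y. \<bar>\<rho> y - marg (g n) y\<bar> \<partial>lborel) \<longlonglongrightarrow> 0"
    using L1_fast_Cauchy_converges[OF moment_funD(4)[OF mm] closem] by blast
  \<comment> \<open>The limit is nonnegative only almost everywhere; truncation selects a
    representative that is nonnegative everywhere, as \<open>moment_fun\<close> demands.\<close>
  define h where "h z = max 0 (k z)" for z
  have [measurable]: "k \<in> borel_measurable borel" using borel_measurable_integrable[OF k] by simp
  have hmeas: "h \<in> borel_measurable borel" unfolding h_def by measurable
  have kh: "AE z in lborel. k z = h z"
    using kae
  proof eventually_elim
    case (elim z)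
    have "0 \<le> k z" by (rule LIMSEQ_le_const[OF elim]) (use gm(4) in auto)
    then show ?case by (simp add: h_def)
  qed
  have hae: "AE z in lborel. (\<lambda>n. g n z) \<longlonglongrightarrow> h z" using kae kh by eventually_elim simp
  have hi: "integrable lborel h" unfolding h_def by (intro integrable_max k integrable_zero)
  have hL: "(\<lambda>n. \<integral>z. \<bar>h z - g n z\<bar> \<partial>lborel) \<longlonglongrightarrow> 0"
  proof -
    have "(\<integral>z. \<bar>k z - g n z\<bar> \<partial>lborel) = (\<integral>z. \<bar>h z - g n z\<bar> \<partial>lborel)" for n
      by (rule integral_cong_AE) (use hmeas gm(3) kh in \<open>auto elim: eventually_mono\<close>)
    then show ?thesis using kL by simp
  qed
  obtain \<theta> Q where t: "0 < \<theta>" and lo: "\<And>g. plan g \<Longrightarrow> \<theta> * (\<integral>z. mweight z * g z \<partial>lborel) - Q \<le> J g"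
    using J_parts_lower by metis
  define B where "B = (J_inf + 1 + Q) / \<theta>"
  have W: "(\<integral>z. mweight z * g n z \<partial>lborel) \<le> B" for n
    using lo[OF g[of n]] gJ[of n] d1[of n] t unfolding B_def by (simp add: le_divide_eq mult.commute)
  have mh: "integrable lborel (\<lambda>z. mweight z * h z)"
  proof (rule integrable_Fatou_real[where Fn = "\<lambda>n z. mweight z * g n z" and l = "\<lambda>n. B" and L = B, THEN conjunct1])
    show "AE z in lborel. (\<lambda>n. mweight z * g n z) \<longlonglongrightarrow> mweight z * h z"
      using hae by eventually_elim (intro tendsto_intros)
    show "AE z in lborel. 0 \<le> mweight z * g n z" for n using gm(4) by (simp add: add_nonneg_nonneg)
  qed (use W gm(5) hmeas in simp_all)
  \<comment> \<open>Fatou's lemma would only give mass at most one; convergence in L1 preserves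
    it.\<close>
  have h1: "(\<integral>z. h z \<partial>lborel) = 1"
  proof -
    have "\<bar>(\<integral>z. h z \<partial>lborel) - 1\<bar> \<le> (\<integral>z. \<bar>h z - g n z\<bar> \<partial>lborel)" for n
    proof -
      have "(\<integral>z. h z \<partial>lborel) - 1 = (\<integral>z. h z - g n z \<partial>lborel)" using hi gm(2,6) by simp
      then show ?thesis using integral_abs_bound[of lborel "\<lambda>z. h z - g n z"] by simp
    qed
    then have "\<bar>(\<integral>z. h z \<partial>lborel) - 1\<bar> \<le> 0" by (intro LIMSEQ_le_const[OF hL]) auto
    then show ?thesis by simp
  qed
  have ph: "prob_density h" using hmeas mh h1 by (simp add: prob_density_def moment_fun_def h_def)
  have pm: "prob_space \<mu>" "sets \<mu> = sets borel" using \<mu> by (auto simp: P2r_def P2_def)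
  have fst: "distr (dmeasure h) borel fst = \<mu>"
  proof (rule distr_dmeasure_eqI[where T = "fst :: 'a \<times> 'a \<Rightarrow> 'a"])
    show "prob_space (distr (dmeasure h) borel fst)"
      by (rule prob_space.prob_space_distr[OF prob_space_dmeasure[OF ph]]) (simp add: borel_fst_snd)
    fix e :: real assume "0 < e"
    then obtain n where "(\<integral>z. \<bar>h z - g n z\<bar> \<partial>lborel) < e"
      using order_tendstoD(2)[OF hL] by (auto simp: eventually_sequentially)
    then show "\<exists>g k :: 'a \<times> 'a \<Rightarrow> real. prob_density g \<and> prob_density k \<and> (\<integral>x. \<bar>g x - k x\<bar> \<partial>lborel) \<le> e \<and>
      distr (dmeasure g) borel fst = distr (dmeasure h) borel fst \<and> distr (dmeasure k) borel fst = \<mu>"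
      using ph planD(1,2)[OF g[of n]] by (intro exI[of _ h] exI[of _ "g n"]) auto
  qed (use pm borel_fst_snd in simp_all)
  \<comment> \<open>The limit \<rho> of the marginals must be identified with the marginal of the
    limit: both are L1 limits of the same sequence.\<close>
  have "(\<integral>y. \<bar>marg h y - \<rho> y\<bar> \<partial>lborel) = 0"
  proof -
    note mhi = moment_funD(4)[OF moment_marg[OF ph]]
    have "(\<integral>y. \<bar>marg h y - \<rho> y\<bar> \<partial>lborel) \<le> (\<integral>z. \<bar>h z - g n z\<bar> \<partial>lborel) + (\<integral>y. \<bar>\<rho> y - marg (g n) y\<bar> \<partial>lborel)" for n
    proof -
      have "(\<integral>y. \<bar>marg h y - \<rho> y\<bar> \<partial>lborel) \<le> (\<integral>y. \<bar>marg h y - marg (g n) y\<bar> + \<bar>\<rho> y - marg (g n) y\<bar> \<partial>lborel)"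
        by (intro integral_mono integrable_abs Bochner_Integration.integrable_add Bochner_Integration.integrable_diff mhi \<rho> moment_funD(4)[OF mm]) auto
      also have "\<dots> = (\<integral>y. \<bar>marg h y - marg (g n) y\<bar> \<partial>lborel) + (\<integral>y. \<bar>\<rho> y - marg (g n) y\<bar> \<partial>lborel)"
        by (intro Bochner_Integration.integral_add integrable_abs Bochner_Integration.integrable_diff mhi \<rho> moment_funD(4)[OF mm])
      also have "\<dots> \<le> (\<integral>z. \<bar>h z - g n z\<bar> \<partial>lborel) + (\<integral>y. \<bar>\<rho> y - marg (g n) y\<bar> \<partial>lborel)"
        by (intro add_right_mono marg_L1 hi gm)
      finally show ?thesis .
    qed
    moreover have "(\<lambda>n. (\<integral>z. \<bar>h z - g n z\<bar> \<partial>lborel) + (\<integral>y. \<bar>\<rho> y - marg (g n) y\<bar> \<partial>lborel)) \<longlonglongrightarrow> 0 + 0"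
      by (intro tendsto_add hL rL)
    ultimately have "(\<integral>y. \<bar>marg h y - \<rho> y\<bar> \<partial>lborel) \<le> 0 + 0" by (intro LIMSEQ_le_const) auto
    moreover have "0 \<le> (\<integral>y. \<bar>marg h y - \<rho> y\<bar> \<partial>lborel)" by simp
    ultimately show ?thesis by linarith
  qed
  then have "AE y in lborel. \<bar>marg h y - \<rho> y\<bar> = 0"
    using moment_funD(4)[OF moment_marg[OF ph]] \<rho> by (subst (asm) integral_nonneg_eq_0_iff_AE) simp_all
  then have mae: "AE y in lborel. (\<lambda>n. marg (g n) y) \<longlonglongrightarrow> marg h y"
    using rae by eventually_elim simp
  have "plan h \<and> J h \<le> J_inf"
    by (rule J_lsc[OF g less_imp_le[OF gJ] dl d1 W hae mae ph fst])
  then show ?thesis using J_inf_le by force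
qed

section \<open>Transfer from plan densities to the functional on measures\<close>

definition objective :: "'a measure \<Rightarrow> ereal" where
  "objective \<nu> = ereal \<kappa> * reg_cost c \<epsilon> \<mu> \<nu> + free_energy f u \<nu>"

lemma free_energy_eq:
  assumes r: "prob_density r"
  shows "free_energy f u (dmeasure r) = ereal (\<integral>y. f y * r y \<partial>lborel) +
    (if integrable lborel (\<lambda>y. u (r y)) then ereal (\<integral>y. u (r y) \<partial>lborel) else \<infinity>)"
proof -
  note m = prob_densityD[OF r]
  have fi: "integrable lborel (\<lambda>y. f y * r y)" by (rule f_integrable[OF m(1)])
  have "eintegral lborel (\<lambda>y. f y * r y) = ereal (\<integral>y. f y * r y \<partial>lborel)"
    using fi m(4) f_nonneg by (subst eintegral_nonneg_eq[OF borel_measurable_integrable[OF fi]]) simp_all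
  then show ?thesis
    unfolding free_energy_def potential_energy_def internal_energy_def
      eintegral_lborel_dens[OF r, of "\<lambda>y s. f y * s"] eintegral_lborel_dens[OF r, of "\<lambda>y. u"]
      eintegral_energy[OF u m(1)] by simp
qed

lemma plan_cost_eq:
  assumes g: "prob_density g"
  shows "eintegral (dmeasure g) c + ereal \<epsilon> * entropy_fun (dmeasure g) =
    ereal (\<integral>z. c z * g z \<partial>lborel) + ereal \<epsilon> *
      (if integrable lborel (\<lambda>z. g z * ln (g z)) then ereal (\<integral>z. g z * ln (g z) \<partial>lborel) else \<infinity>)"
  unfolding eintegral_dmeasure[OF g c_meas c_nonneg c_le]
  using dmeasure_P2r(1)[OF g] eintegral_lborel_dens[OF g, of "\<lambda>z s. s * ln s"]
    eintegral_energy[OF energy_integrand_entropy prob_densityD(1)[OF g]]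
  by (simp add: entropy_fun_def)

lemma objective_le_J:
  assumes g: "plan g"
  shows "dmeasure (marg g) \<in> P2r" "objective (dmeasure (marg g)) \<le> ereal (J g)"
proof -
  note p = planD[OF g]
  show "dmeasure (marg g) \<in> P2r" by (rule dmeasure_P2r(1)[OF prob_density_marg[OF p(1)]])
  have "dmeasure g \<in> couplings \<mu> (dmeasure (marg g))"
    using prob_space_dmeasure[OF p(1)] p(2) distr_snd_dmeasure[OF p(1)] by (simp add: couplings_def)
  then have "reg_cost c \<epsilon> \<mu> (dmeasure (marg g)) \<le> eintegral (dmeasure g) c + ereal \<epsilon> * entropy_fun (dmeasure g)"
    unfolding reg_cost_def by (rule INF_lower)
  also have "\<dots> = ereal ((\<integral>z. c z * g z \<partial>lborel) + \<epsilon> * (\<integral>z. g z * ln (g z) \<partial>lborel))"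
    unfolding plan_cost_eq[OF p(1)] using p(3) by simp
  finally have "ereal \<kappa> * reg_cost c \<epsilon> \<mu> (dmeasure (marg g)) \<le> ereal \<kappa> * \<dots>"
    using \<kappa> by (intro ereal_mult_left_mono) simp_all
  then have "objective (dmeasure (marg g)) \<le> ereal \<kappa> * ereal ((\<integral>z. c z * g z \<partial>lborel) + \<epsilon> * (\<integral>z. g z * ln (g z) \<partial>lborel))
     + free_energy f u (dmeasure (marg g))"
    unfolding objective_def by (rule add_right_mono)
  also have "\<dots> = ereal (J g)"
    unfolding free_energy_eq[OF prob_density_marg[OF p(1)]] using p(4) by (simp add: J_def)
  finally show "objective (dmeasure (marg g)) \<le> ereal (J g)" .
qed

text \<open>Attainment of the infimum over couplings is not presupposed: the strict bound selects
  some coupling below the level. A coupling outside \<open>P2r\<close> has infinite entropy and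
  cannot be the selected one.\<close>

lemma plan_of_objective:
  assumes \<nu>: "\<nu> \<in> P2r" and less: "objective \<nu> < ereal r"
  obtains g where "plan g" "dmeasure (marg g) = \<nu>" "J g < r"
proof -
  have pn: "prob_density (dens \<nu>)" by (rule P2r_dens(2)[OF \<nu>])
  have fe: "free_energy f u \<nu> = ereal (\<integral>y. f y * dens \<nu> y \<partial>lborel) +
    (if integrable lborel (\<lambda>y. u (dens \<nu> y)) then ereal (\<integral>y. u (dens \<nu> y) \<partial>lborel) else \<infinity>)"
    using free_energy_eq[OF pn] by (simp add: P2r_dens(1)[OF \<nu>])
  have ui: "integrable lborel (\<lambda>y. u (dens \<nu> y))"
    using less unfolding objective_def fe by (auto split: if_splits)
  define F where "F = (\<integral>y. f y * dens \<nu> y \<partial>lborel) + (\<integral>y. u (dens \<nu> y) \<partial>lborel)"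
  have feF: "free_energy f u \<nu> = ereal F" unfolding fe F_def using ui by simp
  have "reg_cost c \<epsilon> \<mu> \<nu> < ereal ((r - F) / \<kappa>)"
  proof (cases "reg_cost c \<epsilon> \<mu> \<nu>")
    case (real w)
    then show ?thesis using less \<kappa> unfolding objective_def feF by (simp add: field_simps)
  qed (use less \<kappa> in \<open>simp_all add: objective_def feF\<close>)
  then obtain \<gamma> where \<gamma>: "\<gamma> \<in> couplings \<mu> \<nu>"
    and \<gamma>r: "eintegral \<gamma> c + ereal \<epsilon> * entropy_fun \<gamma> < ereal ((r - F) / \<kappa>)"
    unfolding reg_cost_def by (auto simp: INF_less_iff)
  have P: "\<gamma> \<in> P2r"
  proof (rule ccontr)
    assume "\<gamma> \<notin> P2r"
    then have "entropy_fun \<gamma> = \<infinity>" by (simp add: entropy_fun_def)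
    moreover have "c \<in> borel_measurable \<gamma>"
      using c_meas \<gamma> by (simp add: couplings_def cong: measurable_cong_sets)
    then have "eintegral \<gamma> c \<noteq> - \<infinity>" using c_nonneg by (simp add: eintegral_nonneg_eq)
    ultimately have inf: "eintegral \<gamma> c + ereal \<epsilon> * entropy_fun \<gamma> = \<infinity>" using \<epsilon> by simp
    show False using \<gamma>r unfolding inf by simp
  qed
  define g where "g = dens \<gamma>"
  have g: "prob_density g" and eq: "dmeasure g = \<gamma>" unfolding g_def using P2r_dens[OF P] by simp_all
  have gi: "integrable lborel (\<lambda>z. g z * ln (g z))"
    using \<gamma>r \<epsilon> unfolding eq[symmetric] plan_cost_eq[OF g] by (auto split: if_splits)
  have gr: "(\<integral>z. c z * g z \<partial>lborel) + \<epsilon> * (\<integral>z. g z * ln (g z) \<partial>lborel) < (r - F) / \<kappa>"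
    using \<gamma>r gi unfolding eq[symmetric] plan_cost_eq[OF g] by simp
  have fst: "distr (dmeasure g) borel fst = \<mu>" and snd: "distr (dmeasure g) borel snd = \<nu>"
    using \<gamma> unfolding eq by (simp_all add: couplings_def)
  have mg: "dmeasure (marg g) = \<nu>" using distr_snd_dmeasure[OF g] snd by simp
  have pm: "prob_density (marg g)" by (rule prob_density_marg[OF g])
  \<comment> \<open>\<open>dens \<nu>\<close> and \<open>marg g\<close> are densities of the same
    measure, so evaluating the free energy with the latter shows that its internal energy is finite
    too.\<close>
  have "free_energy f u (dmeasure (marg g)) = ereal F" using feF mg by simp
  then have mi: "integrable lborel (\<lambda>y. u (marg g y))"
    and mF: "(\<integral>y. f y * marg g y \<partial>lborel) + (\<integral>y. u (marg g y) \<partial>lborel) = F"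
    unfolding free_energy_eq[OF pm] by (auto split: if_splits)
  have "plan g" unfolding plan_def using g fst gi mi by simp
  moreover have "J g < r"
    using gr mF \<kappa> unfolding J_def by (simp add: less_divide_eq algebra_simps)
  ultimately show ?thesis using that mg by blast
qed

lemma J_inf_le_objective:
  assumes "\<nu> \<in> P2r" shows "ereal J_inf \<le> objective \<nu>"
proof (rule ccontr)
  assume "\<not> ereal J_inf \<le> objective \<nu>"
  then obtain g where "plan g" "J g < J_inf" using plan_of_objective[OF assms, of J_inf] by (auto simp: not_le)
  then show False using J_inf_le[of g] by simp
qed

text \<open>The minimisers are the measures at level \<open>J_inf\<close>. For a second minimiser
  only near-optimal plans are at hand; they approach \<open>h\<close> in L1 as the error vanishes,
  so their common second marginal is that of \<open>h\<close>.\<close>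

theorem ex1_minimiser: "\<exists>!\<nu>. is_arg_min objective (\<lambda>\<nu>. \<nu> \<in> P2r) \<nu>"
proof -
  obtain h where h: "plan h" "J h = J_inf" using J_attained by blast
  have min_iff: "is_arg_min objective (\<lambda>\<nu>. \<nu> \<in> P2r) \<nu> \<longleftrightarrow> \<nu> \<in> P2r \<and> objective \<nu> \<le> ereal J_inf" for \<nu>
    using objective_le_J[OF h(1)] J_inf_le_objective unfolding is_arg_min_def h(2) by (meson leD leI order_trans)
  show ?thesis
  proof (rule ex1I)
    show "is_arg_min objective (\<lambda>\<nu>. \<nu> \<in> P2r) (dmeasure (marg h))"
      unfolding min_iff using objective_le_J[OF h(1)] h(2) by simp
    fix \<nu> assume "is_arg_min objective (\<lambda>\<nu>. \<nu> \<in> P2r) \<nu>"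
    then have \<nu>: "\<nu> \<in> P2r" "objective \<nu> \<le> ereal J_inf" unfolding min_iff by auto
    show "\<nu> = dmeasure (marg h)"
    proof (rule distr_dmeasure_eqI[where T = "snd :: 'a \<times> 'a \<Rightarrow> 'a"])
      show "prob_space \<nu>" "sets \<nu> = sets borel" using \<nu>(1) by (simp_all add: P2r_def P2_def)
      show "prob_space (dmeasure (marg h))"
        by (rule prob_space_dmeasure[OF prob_density_marg[OF planD(1)[OF h(1)]]])
      fix e :: real assume e: "0 < e"
      define K where "K = 2 / (\<kappa> * \<epsilon>) + 6"
      \<comment> \<open>Tuned so that the distance bound of \<open>almost_minimisers_close\<close>
        equals \<open>e\<close>.\<close>
      define d where "d = (e / K)\<^sup>2"
      have K: "0 < K" using \<kappa> \<epsilon> by (simp add: K_def add_pos_pos)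
      have d: "0 < d" "K * sqrt d = e" using K e by (simp_all add: d_def)
      have "objective \<nu> < ereal (J_inf + d)" using \<nu>(2) d by (simp add: le_less_trans)
      then obtain g where g: "plan g" "dmeasure (marg g) = \<nu>" "J g < J_inf + d"
        using plan_of_objective[OF \<nu>(1)] by blast
      have "(\<integral>z. \<bar>g z - h z\<bar> \<partial>lborel) \<le> e"
        using almost_minimisers_close[OF g(1) less_imp_le[OF g(3)] h(1) _ d(1) J_inf_le] h(2) d
        unfolding K_def[symmetric] by simp
      then show "\<exists>g k :: 'a \<times> 'a \<Rightarrow> real. prob_density g \<and> prob_density k \<and> (\<integral>x. \<bar>g x - k x\<bar> \<partial>lborel) \<le> e \<and>
        distr (dmeasure g) borel snd = \<nu> \<and> distr (dmeasure k) borel snd = dmeasure (marg h)"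
        using planD(1)[OF g(1)] planD(1)[OF h(1)] distr_snd_dmeasure[OF planD(1)[OF g(1)]]
          distr_snd_dmeasure[OF planD(1)[OF h(1)]] g(2)
        by (intro exI[of _ g] exI[of _ h] conjI) simp_all
    qed (simp_all add: borel_fst_snd)
  qed
qed

end

subsection \<open>Consequences of the assumptions\<close>

text \<open>Continuity at 0 is the delicate point, since convexity on a closed half-line allows a
  jump at the endpoint. Convexity gives u(s) <= s u(1) near 0, and the growth bound supplies the
  other side.\<close>

lemma assumption_E_energy_integrand:
  fixes f :: "real ^ 'n \<Rightarrow> real"
  assumes E: "assumption_E C \<alpha> m f u" and C: "0 < C"
  shows "energy_integrand DIM(real ^ 'n) u"
proof -
  have u0: "u 0 = 0" and conv: "convex_on {0..} u" and c1: "u C1_differentiable_on {0<..}"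
    and \<alpha>: "real CARD('n) / (real CARD('n) + 2) < \<alpha>" "\<alpha> < 1"
    and lo: "\<And>s. 0 \<le> s \<Longrightarrow> - C * s powr \<alpha> \<le> u s"
    using E unfolding assumption_E_def by blast+
  have \<alpha>0: "0 < \<alpha>" using \<alpha>(1) by (smt (verit) divide_nonneg_nonneg of_nat_0_le_iff)
  have mid: "u ((s + t) / 2) \<le> (u s + u t) / 2" if "0 \<le> s" "0 \<le> t" for s t
    using convex_onD[OF conv, of "1/2" s t] that by (simp add: add_divide_distrib)
  have "continuous_on {0..} u"
    unfolding continuous_on_def
  proof (rule ballI)
    fix x :: real assume x: "x \<in> {0..}"
    show "(u \<longlongrightarrow> u x) (at x within {0..})"
    proof (cases "x = 0")
      case True
      have A: "((\<lambda>s. - C * s powr \<alpha>) \<longlongrightarrow> - C * 0 powr \<alpha>) (at 0 within {0..})"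
        using \<alpha>0 by (intro tendsto_intros tendsto_powr') (auto simp: eventually_at_filter)
      have B: "((\<lambda>s. s * u 1) \<longlongrightarrow> 0 * u 1) (at 0 within {0..})" by (intro tendsto_intros)
      have "(u \<longlongrightarrow> 0) (at 0 within {0..})"
      proof (rule tendsto_sandwich[where f = "\<lambda>s. - C * s powr \<alpha>" and h = "\<lambda>s. s * u 1"])
        show "\<forall>\<^sub>F s in at 0 within {0..}. - C * s powr \<alpha> \<le> u s"
          unfolding eventually_at_filter using lo by (auto intro!: always_eventually)
        have "u s \<le> s * u 1" if "0 \<le> s" "s \<le> 1" for s
          using convex_onD[OF conv, of s 0 1] that u0 by simp
        then have "u s \<le> s * u 1" if "s \<in> {0..}" "dist s 0 < 1" for s using that by simp
        then show "\<forall>\<^sub>F s in at 0 within {0..}. u s \<le> s * u 1"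
          unfolding eventually_at by (intro exI[of _ 1]) auto
      qed (use A B \<alpha>0 in simp_all)
      then show ?thesis using True u0 by simp
    next
      case False
      then have x0: "0 < x" using x by simp
      obtain D where "(u has_vector_derivative D) (at x)"
        using c1 x0 unfolding C1_differentiable_on_def by auto
      then have "isCont u x" by (rule has_vector_derivative_continuous)
      then show ?thesis unfolding isCont_def by (rule tendsto_within_subset) simp
    qed
  qed
  with u0 mid \<alpha> lo C show ?thesis unfolding energy_integrand_def
    by (intro conjI exI[of _ C] exI[of _ \<alpha>]) auto
qed

text \<open>\<open>deriv\<close> is a choice operator; the regularity of \<open>u\<close> turns its
  values into genuine derivatives, as the monotonicity arguments below require.\<close>

lemma
  fixes f :: "real ^ 'n \<Rightarrow> real"
  assumes E: "assumption_E C \<alpha> m f u" and s: "0 < s"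
  shows assumption_E_DERIV: "(u has_real_derivative deriv u s) (at s)"
    and assumption_E_DERIV_pressure: "(pressure u has_real_derivative deriv (pressure u) s) (at s)"
proof -
  have c1: "u C1_differentiable_on {0<..}" "deriv u C1_differentiable_on {0<..}"
    using E unfolding assumption_E_def by blast+
  have d: "v field_differentiable (at s)" if "v C1_differentiable_on {0<..}" for v :: "real \<Rightarrow> real"
    using that s unfolding C1_differentiable_on_def field_differentiable_def
    by (auto simp: has_real_derivative_iff_has_vector_derivative)
  show u: "(u has_real_derivative deriv u s) (at s)"
    by (rule DERIV_deriv_iff_field_differentiable[THEN iffD2, OF d[OF c1(1)]])
  have v: "(deriv u has_real_derivative deriv (deriv u) s) (at s)"
    by (rule DERIV_deriv_iff_field_differentiable[THEN iffD2, OF d[OF c1(2)]])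
  have "((\<lambda>s. deriv u s * s - u s) has_real_derivative (deriv (deriv u) s * s + 1 * deriv u s - deriv u s)) (at s)"
    by (intro DERIV_diff DERIV_mult u v DERIV_ident)
  then have p: "(pressure u has_real_derivative (deriv (deriv u) s * s)) (at s)"
    by (simp add: pressure_def[abs_def])
  then show "(pressure u has_real_derivative deriv (pressure u) s) (at s)"
    by (simp add: DERIV_imp_deriv[OF p])
qed

text \<open>For m = 0 the bound p'(s) >= 1/(C s) makes the pressure grow at least like ln s / C,
  against p <= C. Once m >= 1, the lower bound on p' is at least 1/C beyond 1.\<close>

lemma assumption_E_m_pos:
  fixes f :: "real ^ 'n \<Rightarrow> real"
  assumes E: "assumption_E C \<alpha> m f u" and C: "0 < C"
  shows "1 \<le> m"
proof (rule ccontr)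
  assume "\<not> 1 \<le> m"
  then have m: "m = 0" by simp
  let ?p = "pressure u"
  \<comment> \<open>Large enough for p(1) + y / C to exceed \<open>C\<close>.\<close>
  define y where "y = C * (\<bar>C - ?p 1\<bar> + 1)"
  have y: "0 \<le> y" using C by (simp add: y_def)
  have p: "?p s \<le> C" "1 / (C * s) \<le> deriv ?p s" if "0 < s" for s
    using E that unfolding assumption_E_def m by (auto simp: powr_minus divide_simps mult.commute)
  have "?p 1 - ln 1 / C \<le> ?p (exp y) - ln (exp y) / C"
  proof (rule DERIV_nonneg_imp_nondecreasing[where f = "\<lambda>s. ?p s - ln s / C"])
    fix s :: real assume "1 \<le> s" "s \<le> exp y"
    then have s: "0 < s" by simp
    have "((\<lambda>s. ?p s - ln s / C) has_real_derivative (deriv ?p s - 1 / s / C)) (at s)"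
      using s by (intro DERIV_diff assumption_E_DERIV_pressure[OF E] DERIV_cdivide DERIV_ln_divide)
    moreover have "0 \<le> deriv ?p s - 1 / s / C" using p(2)[OF s] by (simp add: mult.commute)
    ultimately show "\<exists>y. ((\<lambda>s. ?p s - ln s / C) has_real_derivative y) (at s) \<and> 0 \<le> y" by blast
  qed (use y in simp)
  moreover have "ln (exp y) / C = \<bar>C - ?p 1\<bar> + 1" using C by (simp add: y_def)
  ultimately show False using p(1)[of "exp y"] by (simp add: abs_if split: if_splits)
qed

text \<open>Since \<open>(u(s)/s)' = p(s)/s\<^sup>2\<close> and \<open>p' \<ge> 1/C\<close> beyond \<open>1\<close>, the energy density
  grows at least like \<open>s ln s\<close>; hence finite internal energy forces finite entropy.\<close>

lemma assumption_E_entropy_growth: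
  fixes f :: "real ^ 'n \<Rightarrow> real"
  assumes E: "assumption_E C \<alpha> m f u" and C: "0 < C"
  obtains K where "0 \<le> K" "\<And>s. 1 \<le> s \<Longrightarrow> s * ln s \<le> C * u s + K * s"
proof -
  let ?p = "pressure u"
  \<comment> \<open>The constant of integration when p' >= 1/C is integrated from 1, giving p(s) >=
    s/C + D.\<close>
  define D where "D = ?p 1 - 1 / C"
  have pd: "1 / C \<le> deriv ?p s" if "1 \<le> s" for s
  proof -
    have "1 \<le> s powr (real m - 1)"
      using that assumption_E_m_pos[OF E C] by (intro ge_one_powr_ge_zero) simp_all
    then have "1 / C \<le> s powr (real m - 1) / C" using C by (simp add: divide_right_mono)
    also have "\<dots> \<le> deriv ?p s" using E that unfolding assumption_E_def by simp
    finally show ?thesis .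
  qed
  have p: "s / C + D \<le> ?p s" if "1 \<le> s" for s
  proof -
    have "?p 1 - 1 / C \<le> ?p s - s / C"
    proof (rule DERIV_nonneg_imp_nondecreasing[where f = "\<lambda>s. ?p s - s / C", OF that])
      fix t :: real assume t: "1 \<le> t" "t \<le> s"
      then have "((\<lambda>s. ?p s - s / C) has_real_derivative (deriv ?p t - 1 / C)) (at t)"
        by (intro DERIV_diff assumption_E_DERIV_pressure[OF E] DERIV_cdivide DERIV_ident) simp
      then show "\<exists>y. ((\<lambda>s. ?p s - s / C) has_real_derivative y) (at t) \<and> 0 \<le> y"
        using pd[OF t(1)] by (intro exI[of _ "deriv ?p t - 1 / C"]) simp
    qed
    then show ?thesis by (simp add: D_def)
  qed
  \<comment> \<open>The correction D/s absorbs that constant: the derivative of the right-hand side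
    is (p(s) - s/C - D) / s^2, which is nonnegative.\<close>
  have q: "u 1 + D \<le> u s / s - ln s / C + D / s" if "1 \<le> s" for s
  proof -
    have "u 1 / 1 - ln 1 / C + D / 1 \<le> u s / s - ln s / C + D / s"
    proof (rule DERIV_nonneg_imp_nondecreasing[where f = "\<lambda>s. u s / s - ln s / C + D / s", OF that])
      fix t :: real assume t: "1 \<le> t" "t \<le> s"
      then have t0: "0 < t" by simp
      have d: "((\<lambda>s. u s / s - ln s / C + D / s) has_real_derivative
          ((deriv u t * t - u t * 1) / (t * t) - 1 / t / C + (0 * t - D * 1) / (t * t))) (at t)"
        using t0 by (intro DERIV_add DERIV_diff DERIV_divide DERIV_cdivide DERIV_ln_divide assumption_E_DERIV[OF E] DERIV_ident DERIV_const) simp_all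
      have eq: "(deriv u t * t - u t * 1) / (t * t) - 1 / t / C + (0 * t - D * 1) / (t * t)
          = (?p t - (t / C + D)) / (t * t)"
        using t0 by (simp add: pressure_def field_simps)
      have "0 \<le> (?p t - (t / C + D)) / (t * t)" using p[OF t(1)] by simp
      with d[unfolded eq] show "\<exists>y. ((\<lambda>s. u s / s - ln s / C + D / s) has_real_derivative y) (at t) \<and> 0 \<le> y"
        by (intro exI conjI)
    qed
    then show ?thesis by simp
  qed
  show ?thesis
  proof (rule that[of "C * \<bar>D\<bar> + C * \<bar>u 1 + D\<bar>"])
    show "0 \<le> C * \<bar>D\<bar> + C * \<bar>u 1 + D\<bar>" using C by simp
    fix s :: real assume s: "1 \<le> s"
    have "ln s / C \<le> u s / s + D / s - (u 1 + D)" using q[OF s] by simp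
    then have "(C * s) * (ln s / C) \<le> (C * s) * (u s / s + D / s - (u 1 + D))"
      using C s by (intro mult_left_mono) simp_all
    then have "s * ln s \<le> C * u s + C * D - C * (u 1 + D) * s"
      using C s by (simp add: algebra_simps)
    also have "\<dots> \<le> C * u s + C * \<bar>D\<bar> * s + C * \<bar>u 1 + D\<bar> * s"
    proof -
      have "C * D \<le> C * \<bar>D\<bar> * s"
        using C s mult_mono[of D "\<bar>D\<bar>" 1 s] by (simp add: mult.assoc)
      moreover have "- (C * (u 1 + D) * s) \<le> C * \<bar>u 1 + D\<bar> * s"
        using C s mult_right_mono[of "- (u 1 + D)" "\<bar>u 1 + D\<bar>" "C * s"] by (simp add: algebra_simps)
      ultimately show ?thesis by linarith
    qed
    finally show "s * ln s \<le> C * u s + (C * \<bar>D\<bar> + C * \<bar>u 1 + D\<bar>) * s" by (simp add: distrib_right)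
  qed
qed

text \<open>The positive part of r ln r lives where r >= 1, and there the growth bound compares it
  with u(r) and r. The negative part is controlled by the moment through the sublinear lower
  bound.\<close>

lemma assumption_E_finite_entropy:
  fixes f :: "real ^ 'n \<Rightarrow> real"
  assumes E: "assumption_E C \<alpha> m f u" and C: "0 < C" and r: "moment_fun (r :: real ^ 'n \<Rightarrow> real)"
    and ui: "integrable lborel (\<lambda>x. u (r x))"
  shows "integrable lborel (\<lambda>x. r x * ln (r x))"
proof -
  obtain K where K: "0 \<le> K" "\<And>s. 1 \<le> s \<Longrightarrow> s * ln s \<le> C * u s + K * s"
    using assumption_E_entropy_growth[OF E C] by blast
  note m = moment_funD[OF r]
  have [measurable]: "r \<in> borel_measurable borel" by (rule m)
  let ?b = "\<lambda>x. \<bar>C * u (r x)\<bar> + K * r x"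
  have bi: "integrable lborel ?b"
    by (intro Bochner_Integration.integrable_add integrable_abs integrable_mult_right ui m)
  have "r x * ln (r x) \<le> ?b x" for x
  proof (cases "1 \<le> r x")
    case True
    then show ?thesis using K(2)[OF True] by linarith
  next
    case False
    then have "r x * ln (r x) \<le> 0" using m(2)[of x] by (cases "r x = 0") (auto intro: mult_nonneg_nonpos)
    moreover have "0 \<le> ?b x" using K m(2)[of x] by simp
    ultimately show ?thesis by linarith
  qed
  then have "(\<integral>\<^sup>+x. ennreal (r x * ln (r x)) \<partial>lborel) \<le> (\<integral>\<^sup>+x. ennreal (?b x) \<partial>lborel)"
    by (intro nn_integral_mono ennreal_leI)
  also have "\<dots> < \<infinity>"
    using K m(2) by (subst nn_integral_eq_integral[OF bi]) simp_all
  finally have "(\<integral>\<^sup>+x. ennreal (r x * ln (r x)) \<partial>lborel) \<noteq> \<infinity>" by simp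
  moreover have "(\<integral>\<^sup>+x. ennreal (- (r x * ln (r x))) \<partial>lborel) \<noteq> \<infinity>"
    using energy_neg_part_finite[OF energy_integrand_entropy r] by simp
  ultimately show ?thesis unfolding real_integrable_def by simp
qed

text \<open>The bound on h gives C h^2 <= 1/4. In |y|^2 <= 2 |x|^2 + 2 |x - y|^2 the error is then
  at most half of |x|^2 + |y|^2, so |y|^2 can be moved to the left: |y|^2 <= 5 |x|^2 + 4 C
  k.\<close>

lemma assumption_C_coercive:
  fixes x y :: "'a::real_inner"
  assumes "0 < C" "0 < h" "h < 1 / (2 * sqrt C)" "0 \<le> k"
    and c: "(norm (x - y))\<^sup>2 \<le> C * (k + h\<^sup>2 * ((norm x)\<^sup>2 + (norm y)\<^sup>2))"
  shows "(norm (x, y))\<^sup>2 \<le> 6 * (norm x)\<^sup>2 + 4 * C * k"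
proof -
  have "h\<^sup>2 \<le> (1 / (2 * sqrt C))\<^sup>2" using assms by (intro power_mono) auto
  also have "\<dots> = 1 / (4 * C)" using assms by (simp add: power_divide power_mult_distrib)
  finally have "C * h\<^sup>2 \<le> 1 / 4" using assms by (simp add: field_simps)
  then have "(C * h\<^sup>2) * ((norm x)\<^sup>2 + (norm y)\<^sup>2) \<le> 1 / 4 * ((norm x)\<^sup>2 + (norm y)\<^sup>2)"
    by (rule mult_right_mono) simp
  then have d: "(norm (x - y))\<^sup>2 \<le> C * k + 1 / 4 * ((norm x)\<^sup>2 + (norm y)\<^sup>2)"
    using c by (simp add: algebra_simps)
  have "norm y \<le> norm x + norm (x - y)" using norm_triangle_ineq4[of x "x - y"] by simp
  then have "(norm y)\<^sup>2 \<le> (norm x + norm (x - y))\<^sup>2" by (intro power_mono) auto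
  also have "\<dots> \<le> 2 * (norm x)\<^sup>2 + 2 * (norm (x - y))\<^sup>2"
    using zero_le_power2[of "norm x - norm (x - y)"] by (simp add: power2_eq_square algebra_simps)
  finally have y: "(norm y)\<^sup>2 \<le> 2 * (norm x)\<^sup>2 + 2 * (norm (x - y))\<^sup>2" .
  have "Y \<le> 2 * X + 2 * Z \<Longrightarrow> Z \<le> W + 1 / 4 * (X + Y) \<Longrightarrow> X + Y \<le> 6 * X + 4 * W" for W X Y Z :: real
    by (simp add: field_simps)
  from this[OF y d] show ?thesis unfolding norm_Pair_sq mult.assoc .
qed

theorem proposition5p1:
  fixes C \<alpha> hbar :: real and m :: nat
  assumes "C > 0" and "hbar > 0"
  shows "\<exists>h0>0. \<exists>\<epsilon>0>0.
    \<forall>(f :: real ^ 'n \<Rightarrow> real) u A b c.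
      assumption_E C \<alpha> m f u \<longrightarrow> assumption_AB C A b \<longrightarrow> assumption_C C hbar A b c \<longrightarrow>
      (\<forall>h \<epsilon>. \<forall>\<mu>\<in>P2r.
         0 < h \<and> h < h0 \<and> 0 < \<epsilon> \<and> \<epsilon> < \<epsilon>0 \<and> \<epsilon> / h \<le> 1 \<and> free_energy f u \<mu> < \<infinity> \<longrightarrow>
         (\<exists>!\<nu>. is_arg_min
                  (\<lambda>\<nu>. ereal (1 / (2 * h)) * reg_cost (c h) \<epsilon> \<mu> \<nu> + free_energy f u \<nu>)
                  (\<lambda>\<nu>. \<nu> \<in> P2r) \<nu>))"
proof -
  have main: "\<exists>!\<nu>. is_arg_min (\<lambda>\<nu>. ereal (1 / (2 * h)) * reg_cost (c h) \<epsilon> \<mu> \<nu> + free_energy f u \<nu>)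
      (\<lambda>\<nu>. \<nu> \<in> P2r) \<nu>"
    if E: "assumption_E C \<alpha> m f u" and c: "assumption_C C hbar A b c" and \<mu>: "\<mu> \<in> P2r"
      and h: "0 < h" "h < hbar" "h < 1 / (2 * sqrt C)" and \<epsilon>: "0 < \<epsilon>" and fin: "free_energy f u \<mu> < \<infinity>"
    for f :: "real ^ 'n \<Rightarrow> real" and u A b c h \<epsilon> \<mu>
  proof -
    have ch: "continuous_on UNIV (c h)"
      "\<And>x y. (norm (x - y))\<^sup>2 \<le> C * (c h (x, y) + h\<^sup>2 * ((norm x)\<^sup>2 + (norm y)\<^sup>2))"
      "\<exists>K. \<forall>x y. c h (x, y) \<le> K * ((norm x)\<^sup>2 + (norm y)\<^sup>2)" "\<And>x y. 0 \<le> c h (x, y)"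
      using c h(1,2) unfolding assumption_C_def by blast+
    obtain K where K: "\<And>x y. c h (x, y) \<le> K * ((norm x)\<^sup>2 + (norm y)\<^sup>2)" using ch(3) by blast
    have f: "continuous_on UNIV f" "\<And>x. 0 \<le> f x" "\<And>x y. \<bar>f x - f y\<bar> \<le> C * norm (x - y)"
      using E unfolding assumption_E_def by blast+
    note u = assumption_E_energy_integrand[OF E assms(1)]
    note p = P2r_dens(2)[OF \<mu>]
    \<comment> \<open>The potential energy could not offset an infinite internal energy, so
      finiteness of the sum passes to the internal part.\<close>
    have ui: "integrable lborel (\<lambda>x. u (dens \<mu> x))"
    proof (rule ccontr)
      assume "\<not> integrable lborel (\<lambda>x. u (dens \<mu> x))"
      then have "internal_energy u \<mu> = \<infinity>"
        unfolding internal_energy_def eintegral_energy[OF u prob_densityD(1)[OF p]] by simp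
      then show False using fin by (simp add: free_energy_def)
    qed
    \<comment> \<open>The Lipschitz bound at the origin gives \<open>f 0 + C\<close>, coercivity
      gives 6 and \<open>4 * C\<close>, and the absolute value covers a negative
      \<open>K\<close>.\<close>
    interpret entropic_step "c h" f u \<mu> "1 / (2 * h)" \<epsilon> "\<bar>K\<bar>" "f 0 + C" 6 "4 * C"
    proof
      show "0 \<le> c h z" for z using ch(4)[of "fst z" "snd z"] by simp
      show "c h z \<le> \<bar>K\<bar> * mweight z" for z :: "(real ^ 'n) \<times> (real ^ 'n)"
      proof -
        have "c h z \<le> K * (norm z)\<^sup>2" using K[of "fst z" "snd z"] by (cases z) (simp add: norm_Pair_sq)
        also have "\<dots> \<le> \<bar>K\<bar> * mweight z" by (intro mult_mono) auto
        finally show ?thesis .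
      qed
      show "(norm z)\<^sup>2 \<le> 6 * (norm (fst z))\<^sup>2 + 4 * C * c h z" for z :: "(real ^ 'n) \<times> (real ^ 'n)"
        using assumption_C_coercive[OF assms(1) h(1,3) ch(4,2), of "fst z" "snd z"] by simp
      show "f y \<le> (f 0 + C) * mweight y" for y
      proof -
        have "norm y \<le> mweight y"
          using zero_le_power2[of "norm y - 1/2"] by (simp add: power2_eq_square algebra_simps)
        then have "C * norm y \<le> C * mweight y" using assms(1) by simp
        moreover have "f 0 * 1 \<le> f 0 * mweight y" using f(2) by (intro mult_left_mono mweight_ge_1)
        moreover have "f y \<le> f 0 + C * norm y" using f(3)[of y 0] by simp
        ultimately show ?thesis unfolding distrib_right[of "f 0"] by linarith
      qed
      show "integrable lborel (\<lambda>x. dens \<mu> x * ln (dens \<mu> x))"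
        by (rule assumption_E_finite_entropy[OF E assms(1) prob_densityD(1)[OF p] ui])
    qed (use ch(1) assms(1) f u \<mu> h \<epsilon> ui in simp_all)
    show ?thesis using ex1_minimiser unfolding objective_def[abs_def] .
  qed
  show ?thesis
  \<comment> \<open>\<open>hbar\<close> makes the cost assumptions available and 1 / (2 sqrt C)
    makes the cost coercive; neither depends on \<open>f\<close>, \<open>u\<close>, \<open>c\<close>
    or \<mu>.\<close>
  proof (rule exI[of _ "min hbar (1 / (2 * sqrt C))"], intro conjI exI[of _ 1] allI ballI impI)
    show "0 < min hbar (1 / (2 * sqrt C))" "0 < (1::real)" using assms by simp_all
  qed (rule main, auto)
qed

end
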